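(* For any $\varepsilon>0$ and $0<\eta<1/2$ the following holds for all sufficiently large $n$. Every $(n,d,\lambda)$-graph $G$ with $2048\lambda/\eta^2<d\leq \eta n^{1/2-\varepsilon}$ contains a $K_{(1-\eta)d}^{(\ell)}$-subdivision, where $\ell=2\lceil\log(\eta^2 n/4096)\rceil+5$ (natural logarithm).
   Context: An $(n,d,\lambda)$-graph is an $n$-vertex $d$-regular graph all of whose adjacency eigenvalues except the largest one are at most $\lambda$ in absolute value. A graph $G$ contains an $H$-subdivision if there is an injective map $\phi:V(H)\to V(G)$ and, for every edge $uv\in E(H)$, a path $P_{uv}$ in $G$ from $\phi(u)$ to $\phi(v)$, such that the paths $P_{uv}$ are pairwise internally vertex-disjoint (and their interiors avoid $\phi(V(H))$). An $H^{(\ell)}$-subdivision is an $H$-subdivision in which every path $P_{uv}$ has length exactly $\ell+1$. Floors are omitted ($K_{(1-\eta)d}$ means $K_{\lfloor(1-\eta)d\rfloor}$). *)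

theory Defs
  imports "Jordan_Normal_Form.Char_Poly"
begin

definition simple_graph_on :: "nat \<Rightarrow> (nat \<Rightarrow> nat \<Rightarrow> bool) \<Rightarrow> bool" where
  "simple_graph_on n E \<longleftrightarrow>
     (\<forall>u<n. \<forall>v<n. E u v \<longleftrightarrow> E v u) \<and> (\<forall>v<n. \<not> E v v)"

definition degree_on :: "nat \<Rightarrow> (nat \<Rightarrow> nat \<Rightarrow> bool) \<Rightarrow> nat \<Rightarrow> nat" where
  "degree_on n E v = card {u. u < n \<and> E v u}"

definition adj_matrix :: "nat \<Rightarrow> (nat \<Rightarrow> nat \<Rightarrow> bool) \<Rightarrow> real mat" where
  "adj_matrix n E = mat n n (\<lambda>(i, j). if E i j then 1 else 0)"

definition ndlambda_graph :: "nat \<Rightarrow> nat \<Rightarrow> real \<Rightarrow> (nat \<Rightarrow> nat \<Rightarrow> bool) \<Rightarrow> bool" where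
  "ndlambda_graph n d lam E \<longleftrightarrow>
     simple_graph_on n E \<and> (\<forall>v<n. degree_on n E v = d) \<and>
     (\<exists>evs :: real list. length evs = n \<and> sorted_wrt (\<ge>) evs \<and>
        char_poly (adj_matrix n E) = (\<Prod>a\<leftarrow>evs. [:- a, 1:]) \<and>
        (\<forall>i. 1 \<le> i \<and> i < n \<longrightarrow> \<bar>evs ! i\<bar> \<le> lam))"

definition is_path :: "nat \<Rightarrow> (nat \<Rightarrow> nat \<Rightarrow> bool) \<Rightarrow> nat list \<Rightarrow> bool" where
  "is_path n E p \<longleftrightarrow> p \<noteq> [] \<and> distinct p \<and> set p \<subseteq> {..<n} \<and>
     (\<forall>i. Suc i < length p \<longrightarrow> E (p ! i) (p ! Suc i))"

definition interior :: "nat list \<Rightarrow> nat set" where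
  "interior p = set (butlast (tl p))"

definition has_Kk_l_subdivision :: "nat \<Rightarrow> (nat \<Rightarrow> nat \<Rightarrow> bool) \<Rightarrow> nat \<Rightarrow> nat \<Rightarrow> bool" where
  "has_Kk_l_subdivision n E k l \<longleftrightarrow>
     (\<exists>(phi :: nat \<Rightarrow> nat) (P :: nat \<Rightarrow> nat \<Rightarrow> nat list).
        inj_on phi {..<k} \<and> phi ` {..<k} \<subseteq> {..<n} \<and>
        (\<forall>i j. i < j \<and> j < k \<longrightarrow>
           is_path n E (P i j) \<and> length (P i j) = l + 2 \<and>
           hd (P i j) = phi i \<and> last (P i j) = phi j \<and>
           interior (P i j) \<inter> phi ` {..<k} = {}) \<and>
        (\<forall>i j i' j'. i < j \<and> j < k \<and> i' < j' \<and> j' < k \<and> (i, j) \<noteq> (i', j') \<longrightarrow>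
           interior (P i j) \<inter> interior (P i' j') = {}))"

end

theory Submission
  imports Defs "Jordan_Normal_Form.Schur_Decomposition" "HOL-Analysis.Convex" "HOL-Real_Asymp.Real_Asymp"
begin

text \<open>
  The proof follows the Friedman--Pippenger tree embedding method with rollback. A set \<open>S\<close> of used
  vertices is kept \<^emph>\<open>good\<close>: every set \<open>X\<close> of at most \<open>2m\<close> vertices has enough neighbours
  outside \<open>S\<close>. Goodness allows to grow a tree vertex by vertex, and it survives the removal of tree
  vertices that are not needed any more. To connect two leaves by a path of exact length, one grows from
  each of them a path followed by a ternary tree with at least \<open>m\<close> vertices in its last level; any two
  such levels are joined by an edge, and everything but the path through this edge is rolled back.

  It remains to find many stars whose leaves and centres form a good set. Centres are chosen greedily with
  almost disjoint neighbourhoods. Few vertices lose most of their neighbours to these stars; each of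
  them reserves six private neighbours, and by averaging this hurts only few centres, which are dropped.

  All pseudorandomness enters through the expander mixing lemma. Its spectral part avoids diagonalisation:
  for \<open>B = A - (d/n) J\<close> the sequence \<open>\<parallel>B\<^sup>p v\<parallel>\<close> is log-convex in \<open>p\<close> and is bounded through
  the trace of \<open>B\<^sup>2\<^sup>p\<close>.
\<close>

section \<open>The expander mixing lemma\<close>

text \<open>The length is tied to the natural logarithm, and this dictates the shape of the trees.
  With x = \<eta>^2 n / 4096 and h = ceil (ln x), two trees of depths h + 1 and h + 2 must each
  reach m, about 2 x, vertices in their last level. Binary branching gives only about x powr (ln 2)
  vertices, too few. Ternary branching suffices because e < 3, but a full ternary tree of that depth
  has order x powr (ln 3) vertices, too many for the graph. The path in front of each tree absorbs
  the surplus depth, so that a tree costs O(m + h) vertices. The embedding itself cannot produce the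
  stars: a centre needs almost d leaves, whereas a condition on all sets of up to 2 m vertices, a
  constant fraction of the graph, allows only a bounded demand per vertex. Hence goodness of the
  stars needs an argument of its own. The size of m comes from mixing: two sets of more than lam n /
  d vertices are joined by an edge, and lam / d < \<eta>^2 / 2048.\<close>

definition mtrace :: "'a::semiring_1 mat \<Rightarrow> 'a" where
  "mtrace M = (\<Sum>i<dim_row M. M $$ (i, i))"

lemma index_mult_mat_sum:
  assumes "A \<in> carrier_mat n n" "B \<in> carrier_mat n n" "i < n" "j < n"
  shows "(A * B) $$ (i, j) = (\<Sum>l<n. A $$ (i, l) * B $$ (l, j))"
  using assms by (auto simp: scalar_prod_def lessThan_atLeast0)

lemma mtrace_comm:
  fixes A B :: "'a::comm_semiring_1 mat"
  assumes "A \<in> carrier_mat n n" "B \<in> carrier_mat n n"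
  shows "mtrace (A * B) = mtrace (B * A)"
proof -
  have "mtrace (A * B) = (\<Sum>i<n. \<Sum>l<n. A $$ (i, l) * B $$ (l, i))"
    using assms by (simp add: mtrace_def index_mult_mat_sum del: index_mult_mat(1))
  also have "\<dots> = (\<Sum>l<n. \<Sum>i<n. B $$ (l, i) * A $$ (i, l))"
    by (subst sum.swap) (simp add: mult.commute)
  also have "\<dots> = mtrace (B * A)"
    using assms by (simp add: mtrace_def index_mult_mat_sum del: index_mult_mat(1))
  finally show ?thesis .
qed

lemma upper_triangular_pow:
  fixes B :: "'a::comm_semiring_1 mat"
  assumes B: "B \<in> carrier_mat n n" "upper_triangular B"
  shows "(\<forall>i<n. \<forall>j<i. (B ^\<^sub>m p) $$ (i, j) = 0) \<and> (\<forall>i<n. (B ^\<^sub>m p) $$ (i, i) = (B $$ (i, i)) ^ p)"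
proof (induction p)
  case 0
  then show ?case using B by auto
next
  case (Suc p)
  have C: "B ^\<^sub>m p \<in> carrier_mat n n" using B by simp
  have e: "(B ^\<^sub>m Suc p) $$ (i, j) = (\<Sum>l<n. (B ^\<^sub>m p) $$ (i, l) * B $$ (l, j))" if "i < n" "j < n" for i j
    using index_mult_mat_sum[OF C B(1) that] by simp
  have z: "(B ^\<^sub>m p) $$ (i, l) * B $$ (l, j) = 0" if "i < n" "l < n" "l < i \<or> j < l" for i l j
    using Suc.IH B that by (auto dest: upper_triangularD)
  show ?case
  proof (intro conjI allI impI)
    fix i j assume "i < n" "j < i"
    then show "(B ^\<^sub>m Suc p) $$ (i, j) = 0" by (subst e) (auto intro!: sum.neutral z)
  next
    fix i assume i: "i < n"
    have "(\<Sum>l<n. (B ^\<^sub>m p) $$ (i, l) * B $$ (l, i)) = (\<Sum>l\<in>{i}. (B ^\<^sub>m p) $$ (i, l) * B $$ (l, i))"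
      using i z[of i _ i] by (intro sum.mono_neutral_right) (auto simp: neq_iff)
    then show "(B ^\<^sub>m Suc p) $$ (i, i) = (B $$ (i, i)) ^ Suc p" using i e Suc.IH by (simp add: mult.commute)
  qed
qed

text \<open>Schur triangularisation applies because the characteristic polynomial is given in split
  form. The trace is invariant under the similarity, and powers of a triangular matrix have the
  powers of its diagonal on their diagonal.\<close>

lemma mtrace_pow:
  fixes A :: "'a::conjugatable_ordered_field mat"
  assumes A: "A \<in> carrier_mat n n" and c: "char_poly A = (\<Prod>a\<leftarrow>es. [:- a, 1:])"
  shows "mtrace (A ^\<^sub>m p) = (\<Sum>e\<leftarrow>es. e ^ p)"
proof -
  obtain B P Q where BPQ: "schur_decomposition A es = (B, P, Q)" by (metis prod_cases3)
  then have w: "similar_mat_wit A B P Q" "upper_triangular B" "diag_mat B = es"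
    using schur_decomposition[OF A c] by auto
  note car = similar_mat_witD2[OF A w(1)]
  have Bp: "B ^\<^sub>m p \<in> carrier_mat n n" using car by simp
  have "mtrace (A ^\<^sub>m p) = mtrace ((P * B ^\<^sub>m p) * Q)" using similar_mat_wit_pow_id[OF w(1)] by simp
  also have "\<dots> = mtrace (Q * (P * B ^\<^sub>m p))" using car Bp by (intro mtrace_comm[of _ n]) auto
  also have "Q * (P * B ^\<^sub>m p) = (Q * P) * B ^\<^sub>m p" using car Bp by (intro assoc_mult_mat[symmetric]) auto
  also have "\<dots> = B ^\<^sub>m p" using car Bp by simp
  also have "mtrace (B ^\<^sub>m p) = (\<Sum>i<n. (B $$ (i, i)) ^ p)"
    using upper_triangular_pow[OF _ w(2), of n p] car Bp by (simp add: mtrace_def)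
  also have "\<dots> = (\<Sum>e\<leftarrow>es. e ^ p)"
    using car unfolding w(3)[symmetric] diag_mat_def
    by (simp add: comp_def interv_sum_list_conv_sum_set_nat lessThan_atLeast0)
  finally show ?thesis .
qed

section \<open>Operator norm of a symmetric matrix from traces\<close>

text \<open>Taking roots of order \<open>2 ^ k\<close> makes the constant \<open>K\<close> disappear
  in the limit. This removes the factor n that the trace bound loses; only exponents
  \<open>2 ^ k\<close> occur because the norms are compared by repeated squaring.\<close>

lemma le_of_pow2_le:
  fixes s t K :: real
  assumes s: "0 \<le> s" and t: "0 \<le> t" and le: "\<And>k. s ^ (2 ^ k) \<le> K * t ^ (2 ^ k)"
  shows "s \<le> t"
proof (rule ccontr)
  assume "\<not> s \<le> t"
  then have st: "t < s" by simp
  have K: "0 \<le> K * t ^ (2 ^ k)" for k using le[of k] s by (meson order_trans zero_le_power)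
  show False
  proof (cases "t = 0")
    case True
    then show ?thesis using le[of 0] st by simp
  next
    case False
    then have t: "0 < t" using t by simp
    then have r: "1 < s / t" using st by simp
    obtain k where k: "K < (s / t) ^ k" using real_arch_pow[OF r] by blast
    have "(s / t) ^ k \<le> (s / t) ^ (2 ^ k)"
      using r by (intro power_increasing less_imp_le[OF less_exp]) auto
    also have "\<dots> \<le> K" using le[of k] t by (simp add: power_divide divide_le_eq)
    finally show False using k by simp
  qed
qed

text \<open>Log-convexity of the norms of the iterates \<open>b (2 ^ k)\<close> reduces the operator norm to traces.\<close>

lemma symmetric_op_bound:
  fixes b :: "nat \<Rightarrow> nat \<Rightarrow> nat \<Rightarrow> real" and v :: "nat \<Rightarrow> real"
  assumes sym: "\<And>p i j. i < n \<Longrightarrow> j < n \<Longrightarrow> b p i j = b p j i"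
    and mult: "\<And>p i j. 0 < p \<Longrightarrow> i < n \<Longrightarrow> j < n \<Longrightarrow> (\<Sum>l<n. b p i l * b p l j) = b (2 * p) i j"
    and trace: "\<And>p. 0 < p \<Longrightarrow> (\<Sum>i<n. b (2 * p) i i) \<le> real n * lam ^ (2 * p)"
  shows "(\<Sum>i<n. (\<Sum>j<n. b 1 i j * v j)\<^sup>2) \<le> lam\<^sup>2 * (\<Sum>i<n. (v i)\<^sup>2)"
proof -
  define app where "app p i = (\<Sum>j<n. b p i j * v j)" for p i
  define Q where "Q p = (\<Sum>i<n. (app p i)\<^sup>2)" for p
  define q where "q = (\<Sum>i<n. (v i)\<^sup>2)"
  have q0: "0 \<le> q" and Q0: "0 \<le> Q p" for p by (auto simp: q_def Q_def intro: sum_nonneg)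
  have Q_inner: "Q p = (\<Sum>i<n. v i * app (2 * p) i)" if "0 < p" for p
  proof -
    have "Q p = (\<Sum>l<n. \<Sum>i<n. \<Sum>j<n. (b p l i * v i) * (b p l j * v j))"
      by (simp add: Q_def app_def power2_eq_square sum_product)
    also have "\<dots> = (\<Sum>i<n. \<Sum>j<n. \<Sum>l<n. (b p l i * v i) * (b p l j * v j))"
      by (subst sum.swap, rule sum.cong[OF refl], rule sum.swap)
    also have "\<dots> = (\<Sum>i<n. \<Sum>j<n. v i * v j * (\<Sum>l<n. b p i l * b p l j))"
      using sym by (auto simp: sum_distrib_left intro!: sum.cong)
    also have "\<dots> = (\<Sum>i<n. v i * app (2 * p) i)"
      using mult[OF that] by (auto simp: app_def sum_distrib_left mult_ac intro!: sum.cong)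
    finally show ?thesis .
  qed
  have step: "(Q p)\<^sup>2 \<le> q * Q (2 * p)" if "0 < p" for p
    unfolding Q_inner[OF that] unfolding q_def Q_def by (rule Cauchy_Schwarz_ineq_sum)
  \<comment> \<open>Cauchy-Schwarz row by row bounds the operator norm by the Frobenius norm, whose
    square is the trace of the squared matrix.\<close>
  have frob: "Q p \<le> q * (real n * lam ^ (2 * p))" if "0 < p" for p
  proof -
    have "Q p \<le> (\<Sum>i<n. (\<Sum>j<n. (b p i j)\<^sup>2) * q)"
      unfolding Q_def app_def q_def by (intro sum_mono Cauchy_Schwarz_ineq_sum)
    also have "\<dots> = q * (\<Sum>i<n. \<Sum>l<n. b p i l * b p l i)"
      using sym by (auto simp: sum_distrib_left sum_distrib_right power2_eq_square mult_ac intro!: sum.cong)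
    also have "\<dots> = q * (\<Sum>i<n. b (2 * p) i i)" using mult[OF that] by simp
    also have "\<dots> \<le> q * (real n * lam ^ (2 * p))" using trace[OF that] q0 by (intro mult_left_mono)
    finally show ?thesis .
  qed
  show ?thesis
  proof (cases "q = 0")
    case True
    then show ?thesis using frob[of 1] by (simp add: q_def Q_def app_def)
  next
    case False
    then have q: "0 < q" using q0 by simp
    have "(Q 1 / q) ^ (2 ^ k) \<le> Q (2 ^ k) / q" for k
    proof (induction k)
      case (Suc k)
      have "(Q 1 / q) ^ (2 ^ Suc k) = ((Q 1 / q) ^ (2 ^ k))\<^sup>2" by (simp add: mult.commute flip: power_mult)
      also have "\<dots> \<le> (Q (2 ^ k) / q)\<^sup>2" using Suc Q0 q by (intro power_mono) auto
      also have "\<dots> = (Q (2 ^ k))\<^sup>2 / q\<^sup>2" by (rule power_divide)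
      also have "\<dots> \<le> (q * Q (2 * 2 ^ k)) / q\<^sup>2" using step[of "2 ^ k"] by (intro divide_right_mono) auto
      also have "\<dots> = Q (2 ^ Suc k) / q" using q by (simp add: power2_eq_square)
      finally show ?case .
    qed simp
    moreover have "Q (2 ^ k) / q \<le> real n * (lam\<^sup>2) ^ (2 ^ k)" for k
      using frob[of "2 ^ k"] q by (simp add: divide_le_eq mult_ac flip: power_mult)
    ultimately have "(Q 1 / q) ^ (2 ^ k) \<le> real n * (lam\<^sup>2) ^ (2 ^ k)" for k by (rule order_trans)
    moreover have "0 \<le> Q 1 / q" using Q0 q by simp
    ultimately have "Q 1 / q \<le> lam\<^sup>2" using le_of_pow2_le[OF _ zero_le_power2] by blast
    then show ?thesis using q by (simp add: divide_le_eq Q_def app_def q_def)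
  qed
qed

section \<open>The spectrum of a regular graph and edge counts\<close>

lemma pow_mat_add:
  fixes A :: "'a::comm_semiring_1 mat"
  assumes "A \<in> carrier_mat n n"
  shows "A ^\<^sub>m (p + q) = A ^\<^sub>m p * A ^\<^sub>m q"
proof (induction q)
  case 0
  then show ?case using assms by simp
next
  case (Suc q)
  then show ?case using assms by (simp add: assoc_mult_mat[of _ n n _ n _ n])
qed

lemma transpose_pow_mat:
  fixes A :: "'a::comm_semiring_1 mat"
  assumes A: "A \<in> carrier_mat n n"
  shows "transpose_mat (A ^\<^sub>m p) = transpose_mat A ^\<^sub>m p"
proof (induction p)
  case 0
  then show ?case using A by simp
next
  case (Suc p)
  have "transpose_mat (A ^\<^sub>m Suc p) = transpose_mat A * transpose_mat A ^\<^sub>m p"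
    using transpose_mult[of "A ^\<^sub>m p" n n A n] A Suc by simp
  also have "\<dots> = transpose_mat A ^\<^sub>m (1 + p)" using pow_mat_add[of "transpose_mat A" n 1 p] A by simp
  finally show ?case by simp
qed

text \<open>The definition of the graph class bounds all entries of the list but the first, without
  saying what the first is. The all-ones vector has eigenvalue d, so d is in the list, and
  \<open>lam < real d\<close> leaves only the first position for it.\<close>

lemma top_eigenvalue:
  assumes G: "ndlambda_graph n d lam E" and lam: "lam < real d" and n: "0 < n"
    and evs: "length evs = n" "char_poly (adj_matrix n E) = (\<Prod>a\<leftarrow>evs. [:- a, 1:])"
      "\<forall>i. 1 \<le> i \<and> i < n \<longrightarrow> \<bar>evs ! i\<bar> \<le> lam"
  shows "evs ! 0 = real d"
proof -
  let ?A = "adj_matrix n E"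
  have A: "?A \<in> carrier_mat n n" by (simp add: adj_matrix_def)
  have row: "(\<Sum>j<n. ?A $$ (i, j)) = real d" if "i < n" for i
  proof -
    have "(\<Sum>j<n. ?A $$ (i, j)) = (\<Sum>j<n. if E i j then 1 else 0)" using that by (simp add: adj_matrix_def)
    also have "\<dots> = real (card {u. u < n \<and> E i u})" by (simp add: sum.If_cases Int_def lessThan_def conj_commute)
    finally show ?thesis using G that by (simp add: ndlambda_graph_def degree_on_def)
  qed
  define v :: "real vec" where "v = vec n (\<lambda>_. 1)"
  have "?A *\<^sub>v v = real d \<cdot>\<^sub>v v"
  proof (rule eq_vecI)
    fix i assume "i < dim_vec (real d \<cdot>\<^sub>v v)"
    then have i: "i < n" by (simp add: v_def)
    then have "(?A *\<^sub>v v) $ i = (\<Sum>j<n. ?A $$ (i, j))"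
      using A by (simp add: v_def scalar_prod_def lessThan_atLeast0)
    then show "(?A *\<^sub>v v) $ i = (real d \<cdot>\<^sub>v v) $ i" using row[OF i] i by (simp add: v_def)
  qed (use A in \<open>simp add: v_def\<close>)
  moreover have "v \<noteq> 0\<^sub>v n"
  proof
    assume "v = 0\<^sub>v n"
    then have "v $ 0 = 0" using n by simp
    then show False using n by (simp add: v_def)
  qed
  ultimately have "eigenvalue ?A (real d)"
    using A unfolding eigenvalue_def eigenvector_def by (intro exI[of _ v]) (simp add: v_def)
  then have "poly (\<Prod>a\<leftarrow>evs. [:- a, 1:]) (real d) = 0" using eigenvalue_root_char_poly[OF A] evs(2) by simp
  then have "real d \<in> set evs" by (auto simp: poly_prod_list prod_list_zero_iff)
  then obtain i where i: "i < n" "evs ! i = real d" using evs(1) by (auto simp: in_set_conv_nth)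
  have "i = 0"
  proof (rule ccontr)
    assume "i \<noteq> 0"
    then have "\<bar>evs ! i\<bar> \<le> lam" using evs(3)[rule_format, of i] i(1) by simp
    then show False using i lam by simp
  qed
  then show ?thesis using i by simp
qed

text \<open>Inside the square stands the bilinear form of \<open>B = A - (d/n) J\<close> at the
  indicator vectors of \<open>X\<close> and \<open>Y\<close>; Cauchy-Schwarz over \<open>X\<close>
  and the norm bound for \<open>B\<close> applied to the indicator of \<open>Y\<close> finish. The
  squared form avoids roots later.\<close>

theorem expander_mixing:
  assumes G: "ndlambda_graph n d lam E" and lam: "0 \<le> lam" "lam < real d" and n: "0 < n"
    and X: "X \<subseteq> {..<n}" and Y: "Y \<subseteq> {..<n}"
  shows "((\<Sum>x\<in>X. real (card ({u. u < n \<and> E x u} \<inter> Y))) - real d * real (card X) * real (card Y) / real n)\<^sup>2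
     \<le> lam\<^sup>2 * real (card X) * real (card Y)"
proof -
  let ?A = "adj_matrix n E"
  have A: "?A \<in> carrier_mat n n" by (simp add: adj_matrix_def)
  obtain evs where evs: "length evs = n" "char_poly ?A = (\<Prod>a\<leftarrow>evs. [:- a, 1:])"
      "\<forall>i. 1 \<le> i \<and> i < n \<longrightarrow> \<bar>evs ! i\<bar> \<le> lam"
    using G by (auto simp: ndlambda_graph_def)
  define a where "a p i j = (?A ^\<^sub>m p) $$ (i, j)" for p i j
  \<comment> \<open>For positive \<open>p\<close> this is the entry of \<open>B ^ p\<close>: by
    regularity AJ = JA = dJ, and J^2 = nJ, so all mixed terms collapse to a multiple of J.\<close>
  define b where "b p i j = a p i j - real d ^ p / real n" for p i j
  have a1: "a 1 i j = (if E i j then 1 else 0)" if "i < n" "j < n" for i j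
    using that A by (simp add: a_def) (simp add: adj_matrix_def)
  have a_add: "a (p + q) i j = (\<Sum>l<n. a p i l * a q l j)" if "i < n" "j < n" for p q i j
    unfolding a_def pow_mat_add[OF A] using A that by (intro index_mult_mat_sum) auto
  have "transpose_mat ?A = ?A"
    using G by (intro eq_matI) (auto simp: adj_matrix_def ndlambda_graph_def simple_graph_on_def)
  then have a_sym: "a p i j = a p j i" if "i < n" "j < n" for p i j
    using transpose_pow_mat[OF A, of p] A that unfolding a_def
    by (metis carrier_matD index_transpose_mat(1) pow_carrier_mat)
  have row1: "(\<Sum>j<n. a 1 i j) = real d" if "i < n" for i
  proof -
    have "(\<Sum>j<n. a 1 i j) = (\<Sum>j<n. if E i j then 1 else 0)" using a1 that by simp
    also have "\<dots> = real (card {u. u < n \<and> E i u})" by (simp add: sum.If_cases Int_def lessThan_def conj_commute)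
    finally show ?thesis using G that by (simp add: ndlambda_graph_def degree_on_def)
  qed
  have row: "(\<Sum>j<n. a p i j) = real d ^ p" if "i < n" for p i
  proof (induction p)
    case 0
    have "(\<Sum>j<n. a 0 i j) = (\<Sum>j<n. if j = i then 1 else 0)" using A that by (auto simp: a_def intro!: sum.cong)
    then show ?case using that by simp
  next
    case (Suc p)
    have "(\<Sum>j<n. a (Suc p) i j) = (\<Sum>j<n. \<Sum>l<n. a p i l * a 1 l j)"
      using a_add[of i _ p 1] that by simp
    also have "\<dots> = (\<Sum>l<n. a p i l * (\<Sum>j<n. a 1 l j))"
      by (subst sum.swap) (simp add: sum_distrib_left)
    also have "\<dots> = (\<Sum>l<n. a p i l) * real d" using row1 by (simp add: sum_distrib_right)
    finally show ?case using Suc by simp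
  qed
  have bound: "(\<Sum>i<n. (\<Sum>j<n. b 1 i j * v j)\<^sup>2) \<le> lam\<^sup>2 * (\<Sum>i<n. (v i)\<^sup>2)" for v
  proof (rule symmetric_op_bound)
    show "b p i j = b p j i" if "i < n" "j < n" for p i j using a_sym that by (simp add: b_def)
  next
    fix p i j :: nat assume ij: "i < n" "j < n"
    define c where "c = real d ^ p / real n"
    have col: "(\<Sum>l<n. a p l j) = real d ^ p" using row[OF ij(2)] a_sym ij(2) by simp
    have "(\<Sum>l<n. b p i l * b p l j) = (\<Sum>l<n. a p i l * a p l j) - c * (\<Sum>l<n. a p l j)
        - c * (\<Sum>l<n. a p i l) + real n * (c * c)"
      by (simp add: b_def algebra_simps sum.distrib sum_subtractf sum_distrib_left sum_distrib_right flip: c_def)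
    also have "\<dots> = a (2 * p) i j - c * real d ^ p"
    proof -
      have "real n * (c * c) = c * real d ^ p" using n by (simp add: c_def)
      then show ?thesis using col row[OF ij(1)] a_add[OF ij, of p p] by (simp flip: mult_2)
    qed
    also have "c * real d ^ p = real d ^ (2 * p) / real n" by (simp add: c_def mult_2 power_add)
    finally show "(\<Sum>l<n. b p i l * b p l j) = b (2 * p) i j" by (simp add: b_def)
  next
    fix p :: nat
    \<comment> \<open>Subtracting the multiple of J removes exactly the eigenvalue d from the trace;
      the remaining ones are at most lam in absolute value.\<close>
    have "(\<Sum>i<n. b (2 * p) i i) = mtrace (?A ^\<^sub>m (2 * p)) - real d ^ (2 * p)"
      using n A by (simp add: b_def a_def mtrace_def sum_subtractf)
    also have "mtrace (?A ^\<^sub>m (2 * p)) = (\<Sum>i<n. (evs ! i) ^ (2 * p))"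
      using mtrace_pow[OF A evs(2)] evs(1) by (simp add: sum_list_sum_nth lessThan_atLeast0)
    also have "\<dots> = (evs ! 0) ^ (2 * p) + (\<Sum>i\<in>{..<n} - {0}. (evs ! i) ^ (2 * p))"
      using n by (intro sum.remove) auto
    also have "\<dots> - real d ^ (2 * p) = (\<Sum>i\<in>{..<n} - {0}. (evs ! i) ^ (2 * p))"
      using top_eigenvalue[OF G lam(2) n evs] by simp
    also have "\<dots> \<le> (\<Sum>i\<in>{..<n} - {0}. lam ^ (2 * p))"
    proof (rule sum_mono)
      fix i assume "i \<in> {..<n} - {0}"
      then have "\<bar>evs ! i\<bar> \<le> lam" using evs(3) by simp
      then have "\<bar>evs ! i\<bar> ^ (2 * p) \<le> lam ^ (2 * p)" by (intro power_mono) auto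
      then show "(evs ! i) ^ (2 * p) \<le> lam ^ (2 * p)" by (simp add: power_even_abs)
    qed
    also have "\<dots> \<le> real n * lam ^ (2 * p)" using n lam by (simp add: mult_right_mono)
    finally show "(\<Sum>i<n. b (2 * p) i i) \<le> real n * lam ^ (2 * p)" .
  qed
  define v where "v j = (if j \<in> Y then 1 else 0 :: real)" for j
  define w where "w i = (\<Sum>j<n. b 1 i j * v j)" for i
  have fin: "finite X" "finite Y" using X Y finite_subset by blast+
  have w: "w x = real (card ({u. u < n \<and> E x u} \<inter> Y)) - real d * real (card Y) / real n" if "x \<in> X" for x
  proof -
    have x: "x < n" using that X by auto
    have "w x = (\<Sum>j\<in>Y. b 1 x j)"
      unfolding w_def v_def using Y by (simp add: if_distrib[of "\<lambda>t. _ * t"] sum.If_cases Int_absorb1 cong: if_cong)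
    also have "\<dots> = (\<Sum>j\<in>Y. if E x j then 1 else 0) - real d * real (card Y) / real n"
      using a1[OF x] Y by (simp add: b_def sum_subtractf subset_iff)
    also have "(\<Sum>j\<in>Y. if E x j then 1 else 0) = real (card ({u. u < n \<and> E x u} \<inter> Y))"
    proof -
      have "Y \<inter> {j. E x j} = {u. u < n \<and> E x u} \<inter> Y" using Y by auto
      then show ?thesis using fin by (simp add: sum.If_cases)
    qed
    finally show ?thesis .
  qed
  have "(\<Sum>x\<in>X. w x)\<^sup>2 \<le> (\<Sum>x\<in>X. 1\<^sup>2) * (\<Sum>x\<in>X. (w x)\<^sup>2)"
    using Cauchy_Schwarz_ineq_sum[of "\<lambda>_. 1" w X] by simp
  also have "\<dots> \<le> real (card X) * (\<Sum>i<n. (w i)\<^sup>2)"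
    using X by (auto intro!: mult_left_mono sum_mono2)
  also have "\<dots> \<le> real (card X) * (lam\<^sup>2 * (\<Sum>i<n. (v i)\<^sup>2))"
    using bound[of v] unfolding w_def by (intro mult_left_mono) auto
  also have "(\<Sum>i<n. (v i)\<^sup>2) = real (card Y)"
    using Y by (simp add: v_def if_distrib[of "\<lambda>t. t\<^sup>2"] sum.If_cases Int_absorb1 cong: if_cong)
  finally have "(\<Sum>x\<in>X. w x)\<^sup>2 \<le> lam\<^sup>2 * real (card X) * real (card Y)" by (simp add: mult_ac)
  moreover have "(\<Sum>x\<in>X. w x) = (\<Sum>x\<in>X. real (card ({u. u < n \<and> E x u} \<inter> Y))) - real d * real (card X) * real (card Y) / real n"
    using w by (simp add: sum_subtractf)
  ultimately show ?thesis by simp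
qed

section \<open>Extendable sets and rolling back\<close>

text \<open>\<open>joined\<close> is all the pseudorandomness that the embedding uses.
  \<open>A\<close> and \<open>B\<close> may overlap, since \<open>B\<close> will also be the
  complement of the neighbourhood of \<open>A\<close>, which can contain vertices of
  \<open>A\<close>.\<close>

locale joined_graph =
  fixes V :: "'a set" and N :: "'a \<Rightarrow> 'a set" and m :: nat
  assumes finite_V: "finite V"
    and N_subset: "v \<in> V \<Longrightarrow> N v \<subseteq> V"
    and N_sym: "u \<in> V \<Longrightarrow> v \<in> N u \<Longrightarrow> u \<in> N v"
    and m_pos: "1 \<le> m"
    and joined: "A \<subseteq> V \<Longrightarrow> B \<subseteq> V \<Longrightarrow> m \<le> card A \<Longrightarrow> m \<le> card B \<Longrightarrow> \<exists>a\<in>A. \<exists>b\<in>B. b \<in> N a"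
begin

abbreviation Nbs :: "'a set \<Rightarrow> 'a set" where "Nbs X \<equiv> \<Union> (N ` X)"

text \<open>
  The Friedman--Pippenger condition: \<open>S\<close> is the set of used vertices, and \<open>r v\<close> is the number of
  children that \<open>v\<close> may still receive.
\<close>

definition good :: "'a set \<Rightarrow> ('a \<Rightarrow> nat) \<Rightarrow> bool" where
  "good S r \<longleftrightarrow> (\<forall>X\<subseteq>V. card X \<le> 2 * m \<longrightarrow> sum r X \<le> card (Nbs X - S))"

lemma goodD: "good S r \<Longrightarrow> X \<subseteq> V \<Longrightarrow> card X \<le> 2 * m \<Longrightarrow> sum r X \<le> card (Nbs X - S)"
  by (simp add: good_def)

lemma Nbs_subset: "X \<subseteq> V \<Longrightarrow> Nbs X \<subseteq> V"
  using N_subset by blast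

lemma finite_sub: "X \<subseteq> V \<Longrightarrow> finite X"
  using finite_V finite_subset by blast

lemma finite_Nbs: "X \<subseteq> V \<Longrightarrow> finite (Nbs X)"
  by (rule finite_sub[OF Nbs_subset])

lemma good_mono:
  assumes "good S r" and "S' \<subseteq> S" and "\<And>v. v \<in> V \<Longrightarrow> r' v \<le> r v"
  shows "good S' r'"
  unfolding good_def
proof (intro allI impI)
  fix X assume X: "X \<subseteq> V" "card X \<le> 2 * m"
  have "sum r' X \<le> sum r X" using X assms(3) by (intro sum_mono) auto
  also have "\<dots> \<le> card (Nbs X - S)" using goodD[OF assms(1) X] .
  also have "\<dots> \<le> card (Nbs X - S')"
    using finite_sub[OF Nbs_subset[OF X(1)]] assms(2) by (intro card_mono) auto
  finally show "sum r' X \<le> card (Nbs X - S')" .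
qed

lemma card_Nbs_large:
  assumes "X \<subseteq> V" "m \<le> card X"
  shows "card V < card (Nbs X) + m"
proof (rule ccontr)
  assume "\<not> ?thesis"
  moreover have "card (V - Nbs X) = card V - card (Nbs X)"
    using Nbs_subset[OF assms(1)] finite_sub by (intro card_Diff_subset) auto
  ultimately have "m \<le> card (V - Nbs X)" by linarith
  from joined[OF assms(1) _ assms(2) this] show False by auto
qed

text \<open>
  If no neighbour of \<open>s\<close> can be added, each of them is covered by a set on which the condition is
  tight. Tight sets have at most \<open>m\<close> elements and are closed under unions by submodularity, so the
  union of these sets together with \<open>s\<close> violates the condition. In \<open>13 * m\<close>, one \<open>m\<close> bounds the
  non-neighbours of a large set, and \<open>12 * m\<close> is the largest demand of a set of size \<open>2 * m\<close>.
\<close>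

lemma extend:
  assumes good: "good S r" and s: "s \<in> V" "1 \<le> r s" and r: "\<And>v. r v \<le> 6"
    and S: "S \<subseteq> V" "card S + 13 * m \<le> card V"
  shows "\<exists>y\<in>N s - S. good (insert y S) (r(s := r s - 1))"
proof (rule ccontr)
  assume contra: "\<not> ?thesis"
  define crit where "crit X \<longleftrightarrow> X \<subseteq> V \<and> card X \<le> m \<and> sum r X = card (Nbs X - S)" for X
  have large: "sum r X < card (Nbs X - S)" if X: "X \<subseteq> V" "card X \<le> 2 * m" "m < card X" for X
  proof -
    have "sum r X \<le> 6 * card X" using sum_bounded_above[of X r 6] r by simp
    also have "\<dots> \<le> 12 * m" using X by simp
    also have "12 * m < card (Nbs X) - card S"
      using card_Nbs_large[of X] X S by linarith
    also have "\<dots> \<le> card (Nbs X - S)" using S finite_sub by (intro diff_card_le_card_Diff) auto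
    finally show ?thesis .
  qed
  have critI: "crit X" if "X \<subseteq> V" "card X \<le> 2 * m" "sum r X = card (Nbs X - S)" for X
    using large[OF that(1,2)] that unfolding crit_def by fastforce
  have crit_Un: "crit (X \<union> Y)" if "crit X" "crit Y" for X Y
  proof -
    have sub: "X \<subseteq> V" "Y \<subseteq> V" "finite X" "finite Y" using that finite_sub by (auto simp: crit_def)
    have c: "card (X \<union> Y) \<le> 2 * m" using card_Un_le[of X Y] that by (auto simp: crit_def)
    have c': "card (X \<inter> Y) \<le> 2 * m"
      using card_mono[of X "X \<inter> Y"] sub that by (auto simp: crit_def)
    have fin: "finite (Nbs X)" "finite (Nbs Y)" using finite_Nbs[OF sub(1)] finite_Nbs[OF sub(2)] .
    have "card (Nbs (X \<union> Y) - S) + card (Nbs (X \<inter> Y) - S)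
        \<le> card ((Nbs X - S) \<union> (Nbs Y - S)) + card ((Nbs X - S) \<inter> (Nbs Y - S))"
      using fin by (intro add_mono card_mono) auto
    also have "\<dots> = card (Nbs X - S) + card (Nbs Y - S)"
      using fin by (intro card_Un_Int[symmetric]) auto
    also have "\<dots> = sum r X + sum r Y" using that by (auto simp: crit_def)
    also have "\<dots> = sum r (X \<union> Y) + sum r (X \<inter> Y)"
      using sub by (intro sum.union_inter[symmetric]) auto
    finally have "card (Nbs (X \<union> Y) - S) + card (Nbs (X \<inter> Y) - S) \<le> sum r (X \<union> Y) + sum r (X \<inter> Y)" .
    moreover have "sum r (X \<union> Y) \<le> card (Nbs (X \<union> Y) - S)" "sum r (X \<inter> Y) \<le> card (Nbs (X \<inter> Y) - S)"
      using goodD[OF good _ c] goodD[OF good _ c'] sub by auto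
    ultimately show ?thesis using sub c by (intro critI) auto
  qed
  have ex: "\<exists>X. crit X \<and> s \<notin> X \<and> y \<in> Nbs X" if y: "y \<in> N s - S" for y
  proof -
    let ?r = "r(s := r s - 1)"
    obtain X where X: "X \<subseteq> V" "card X \<le> 2 * m" and lt: "card (Nbs X - insert y S) < sum ?r X"
      using contra y unfolding good_def by (meson not_le)
    have fX: "finite X" and fN: "finite (Nbs X)" using finite_sub[OF X(1)] finite_Nbs[OF X(1)] .
    have a: "sum r X \<le> card (Nbs X - S)" using goodD[OF good X] .
    have eq: "Nbs X - insert y S = (Nbs X - S) - {y}" by auto
    have b: "card (Nbs X - S) \<le> card (Nbs X - insert y S) + 1"
      unfolding eq using diff_card_le_card_Diff[of "{y}" "Nbs X - S"] by simp
    have c: "sum ?r X \<le> sum r X" by (intro sum_mono) auto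
    \<comment> \<open>If \<open>s\<close> were in \<open>X\<close>, its demand would drop by one,
      and this would pay for the loss of \<open>y\<close>.\<close>
    have "s \<notin> X"
    proof
      assume "s \<in> X"
      have "sum ?r X < sum r X" using \<open>s \<in> X\<close> fX s by (intro sum_strict_mono_ex1) auto
      then show False using a b lt by linarith
    qed
    moreover have "y \<in> Nbs X"
    proof (rule ccontr)
      assume "y \<notin> Nbs X"
      then have "Nbs X - insert y S = Nbs X - S" by auto
      then show False using a c lt by simp
    qed
    moreover have "crit X" using X a b c lt by (intro critI) auto
    ultimately show ?thesis by blast
  qed
  then obtain F where F: "\<And>y. y \<in> N s - S \<Longrightarrow> crit (F y) \<and> s \<notin> F y \<and> y \<in> Nbs (F y)" by metis
  have "crit (\<Union> (F ` Y))" if "finite Y" "Y \<subseteq> N s - S" for Y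
    using that
  proof (induction Y)
    case empty
    then show ?case by (simp add: crit_def)
  next
    case (insert y Y)
    then show ?case using crit_Un F by simp
  qed
  moreover have "finite (N s - S)" using N_subset[OF s(1)] finite_sub by auto
  ultimately have X: "crit (\<Union> (F ` (N s - S)))" (is "crit ?X") by simp
  have sX: "s \<notin> ?X" using F by auto
  have fX: "finite ?X" using X finite_sub by (simp add: crit_def)
  \<comment> \<open>All neighbours of \<open>s\<close> outside \<open>S\<close> are covered already,
    so adding \<open>s\<close> raises the demand by \<open>r s\<close> but gains no neighbour. The
    condition still applies, as m + 1 is at most 2 m.\<close>
  have "Nbs (insert s ?X) - S = Nbs ?X - S" using F by blast
  moreover have "sum r (insert s ?X) \<le> card (Nbs (insert s ?X) - S)"
    using X s m_pos fX sX by (intro goodD[OF good]) (auto simp: crit_def)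
  moreover have "sum r (insert s ?X) = r s + sum r ?X" using fX sX by simp
  ultimately show False using X s by (simp add: crit_def)
qed

lemma extend_many:
  assumes "good S r" and "s \<in> V" "t \<le> r s" and "\<And>v. r v \<le> 6"
    and "S \<subseteq> V" "card S + t + 13 * m \<le> card V"
  shows "\<exists>U\<subseteq>N s - S. card U = t \<and> good (S \<union> U) (r(s := r s - t))"
  using assms
proof (induction t)
  case 0
  then show ?case by (intro exI[of _ "{}"]) auto
next
  case (Suc t)
  then obtain U where U: "U \<subseteq> N s - S" "card U = t" "good (S \<union> U) (r(s := r s - t))"
    by fastforce
  have fU: "finite U" using U(1) N_subset[OF Suc.prems(2)] finite_sub by blast
  have "card (S \<union> U) \<le> card S + t" using card_Un_le[of S U] U by simp
  moreover have "S \<union> U \<subseteq> V" using U N_subset[OF Suc.prems(2)] Suc.prems by blast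
  moreover have "(r(s := r s - t)) v \<le> 6" for v using Suc.prems(4)[of v] by auto
  ultimately obtain y where y: "y \<in> N s - (S \<union> U)"
    "good (insert y (S \<union> U)) ((r(s := r s - t))(s := (r(s := r s - t)) s - 1))"
    using extend[OF U(3), of s] Suc.prems(2,3,6) by force
  have "(r(s := r s - t))(s := (r(s := r s - t)) s - 1) = r(s := r s - Suc t)" by auto
  then have "good (S \<union> insert y U) (r(s := r s - Suc t))" using y(2) by simp
  moreover have "card (insert y U) = Suc t" using y(1) U(2) fU by simp
  moreover have "insert y U \<subseteq> N s - S" using y(1) U(1) by auto
  ultimately show ?case by blast
qed

text \<open>Serving one element of \<open>A\<close> lowers only its own demand, so those still
  waiting keep theirs. The map \<open>par\<close> records the owner of each new vertex: this makes
  the new neighbours private, and it is the data needed for a later rollback.\<close>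

lemma extend_set:
  assumes "finite A" "A \<subseteq> V" "good S r" "\<And>a. a \<in> A \<Longrightarrow> t \<le> r a" "\<And>v. r v \<le> 6"
    and "S \<subseteq> V" "card S + t * card A + 13 * m \<le> card V"
  shows "\<exists>U par. U \<subseteq> V - S \<and> (\<forall>y\<in>U. par y \<in> A \<and> y \<in> N (par y)) \<and>
           (\<forall>a\<in>A. card {y\<in>U. par y = a} = t) \<and> good (S \<union> U) (\<lambda>v. if v \<in> A then r v - t else r v)"
  using assms
proof (induction A)
  case empty
  then show ?case by (intro exI[of _ "{}"]) auto
next
  case (insert a A)
  then have "\<exists>U par. U \<subseteq> V - S \<and> (\<forall>y\<in>U. par y \<in> A \<and> y \<in> N (par y)) \<and>
           (\<forall>a\<in>A. card {y\<in>U. par y = a} = t) \<and> good (S \<union> U) (\<lambda>v. if v \<in> A then r v - t else r v)"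
    by (intro insert.IH) auto
  then obtain U par where U: "U \<subseteq> V - S" "\<forall>y\<in>U. par y \<in> A \<and> y \<in> N (par y)"
     "\<forall>a\<in>A. card {y\<in>U. par y = a} = t"
     "good (S \<union> U) (\<lambda>v. if v \<in> A then r v - t else r v)"
    by (elim exE conjE)
  let ?r = "\<lambda>v. if v \<in> A then r v - t else r v"
  have fU: "finite U" using U(1) finite_sub by blast
  have "U = (\<Union>a\<in>A. {y\<in>U. par y = a})" using U(2) by auto
  then have "card U \<le> (\<Sum>a\<in>A. card {y\<in>U. par y = a})" using card_UN_le insert.hyps(1) by metis
  then have "card U \<le> t * card A" using U(3) by (simp add: mult.commute)
  then have "card (S \<union> U) + t + 13 * m \<le> card V"
    using card_Un_le[of S U] insert.prems(6) insert.hyps by simp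
  moreover have "?r v \<le> 6" for v using insert.prems(4)[of v] by auto
  moreover have "a \<in> V" "t \<le> ?r a" "S \<union> U \<subseteq> V"
    using insert.prems(1,3,5) insert.hyps(2) U(1) by auto
  ultimately have "\<exists>U'\<subseteq>N a - (S \<union> U). card U' = t \<and> good ((S \<union> U) \<union> U') (?r(a := ?r a - t))"
    by (intro extend_many[OF U(4)])
  then obtain U' where U': "U' \<subseteq> N a - (S \<union> U)" "card U' = t"
     "good ((S \<union> U) \<union> U') (?r(a := ?r a - t))"
    by (elim exE conjE)
  let ?par = "\<lambda>y. if y \<in> U' then a else par y"
  have disj: "U' \<inter> U = {}" using U'(1) by blast
  have e1: "{y \<in> U \<union> U'. ?par y = b} = {y\<in>U. par y = b}" if "b \<in> A" for b
    using that insert.hyps(2) disj by (auto split: if_splits)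
  have e2: "{y \<in> U \<union> U'. ?par y = a} = U'" using insert.hyps(2) U(2) by auto
  have r_eq: "?r(a := ?r a - t) = (\<lambda>v. if v \<in> insert a A then r v - t else r v)"
    using insert.hyps(2) by auto
  have "good (S \<union> (U \<union> U')) (\<lambda>v. if v \<in> insert a A then r v - t else r v)"
    using U'(3) unfolding r_eq Un_assoc .
  moreover have "N a \<subseteq> V" using insert.prems(1) N_subset by simp
  then have "U \<union> U' \<subseteq> V - S" using U(1) U'(1) by blast
  moreover have "\<forall>y\<in>U \<union> U'. ?par y \<in> insert a A \<and> y \<in> N (?par y)"
  proof
    fix y assume "y \<in> U \<union> U'"
    then show "?par y \<in> insert a A \<and> y \<in> N (?par y)"
      using U(2) U'(1) by (cases "y \<in> U'") auto
  qed
  moreover have "\<forall>b\<in>insert a A. card {y \<in> U \<union> U'. ?par y = b} = t"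
  proof
    fix b assume "b \<in> insert a A"
    then consider "b = a" | "b \<in> A" by blast
    then show "card {y \<in> U \<union> U'. ?par y = b} = t"
      by cases (simp_all only: e1 e2 U'(2) U(3)[rule_format])
  qed
  ultimately show ?case by (intro exI[of _ "U \<union> U'"] exI[of _ ?par] conjI)
qed

text \<open>Each removed vertex becomes a free neighbour of its parent again. For a set
  \<open>X\<close>, the fibres of \<open>par\<close> over \<open>X\<close> are disjoint subsets of
  its neighbourhood, so \<open>X\<close> regains at least as many free neighbours as its demand
  increases.\<close>

lemma rollback:
  assumes good: "good S r" and "S \<subseteq> V" "R \<subseteq> S" and par: "\<And>y. y \<in> R \<Longrightarrow> y \<in> N (par y)"
  shows "good (S - R) (\<lambda>v. r v + card {y\<in>R. par y = v})"
  unfolding good_def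
proof (intro allI impI)
  fix X assume X: "X \<subseteq> V" "card X \<le> 2 * m"
  have fin: "finite X" "finite (Nbs X)" "finite R"
    using finite_sub[OF X(1)] finite_Nbs[OF X(1)] finite_sub[of R] assms(2,3) by auto
  have "(\<Sum>x\<in>X. card {y\<in>R. par y = x}) = card (\<Union>x\<in>X. {y\<in>R. par y = x})"
    using fin by (intro card_UN_disjoint[symmetric]) auto
  also have "\<dots> \<le> card (Nbs X \<inter> R)" using par fin by (intro card_mono) auto
  finally have "(\<Sum>x\<in>X. r x + card {y\<in>R. par y = x}) \<le> card (Nbs X - S) + card (Nbs X \<inter> R)"
    using goodD[OF good X] by (simp add: sum.distrib)
  also have "\<dots> = card ((Nbs X - S) \<union> (Nbs X \<inter> R))"
    using fin assms(3) by (intro card_Un_disjoint[symmetric]) auto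
  also have "\<dots> \<le> card (Nbs X - (S - R))" using fin by (intro card_mono) auto
  finally show "(\<Sum>x\<in>X. r x + card {y\<in>R. par y = x}) \<le> card (Nbs X - (S - R))" .
qed

section \<open>Linking prescribed pairs by paths of prescribed length\<close>

definition children :: "'a set \<Rightarrow> ('a \<Rightarrow> 'a) \<Rightarrow> 'a \<Rightarrow> nat" where
  "children T par v = card {y\<in>T. par y = v}"

definition forest :: "'a set \<Rightarrow> ('a \<Rightarrow> nat) \<Rightarrow> 'a set \<Rightarrow> ('a \<Rightarrow> 'a) \<Rightarrow> bool" where
  "forest S r T par \<longleftrightarrow> T \<subseteq> V - S \<and> (\<forall>y\<in>T. y \<in> N (par y) \<and> par y \<in> S \<union> T) \<and>
     good (S \<union> T) (\<lambda>v. r v - children T par v)"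

definition branch :: "('a \<Rightarrow> 'a) \<Rightarrow> 'a \<Rightarrow> 'a list \<Rightarrow> bool" where
  "branch par x p \<longleftrightarrow> p \<noteq> [] \<and> hd p = x \<and> distinct p \<and> (\<forall>i. Suc i < length p \<longrightarrow> par (p ! Suc i) = p ! i)"

text \<open>
  \<open>A\<close> is level \<open>j\<close> of a tree rooted at \<open>x\<close> that was added to the forest \<open>T0\<close>, giving \<open>T\<close>.
\<close>

definition grown :: "'a set \<Rightarrow> ('a \<Rightarrow> nat) \<Rightarrow> 'a set \<Rightarrow> ('a \<Rightarrow> 'a) \<Rightarrow> 'a \<Rightarrow> nat \<Rightarrow> 'a set \<Rightarrow> 'a set \<Rightarrow> ('a \<Rightarrow> 'a) \<Rightarrow> bool" where
  "grown S r T0 par0 x j A T par \<longleftrightarrow> forest S r T par \<and> T0 \<subseteq> T \<and> (\<forall>y\<in>T0. par y = par0 y) \<and>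
     (\<forall>y\<in>T - T0. par y \<in> insert x (T - T0)) \<and> A \<subseteq> insert x (T - T0) \<and>
     (\<forall>a\<in>A. children T par a = 0 \<and>
        (\<exists>p. branch par x p \<and> set (tl p) \<subseteq> T - T0 \<and> last p = a \<and> length p = Suc j))"

lemma branch_cong:
  assumes "branch par x p" "\<And>y. y \<in> set (tl p) \<Longrightarrow> par' y = par y"
  shows "branch par' x p"
proof -
  have "p ! Suc i \<in> set (tl p)" if "Suc i < length p" for i
    using that nth_mem[of i "tl p"] by (simp add: nth_tl)
  then show ?thesis using assms by (auto simp: branch_def)
qed

lemma branch_append:
  assumes "branch par x p" "par y = last p" "y \<notin> set p"
  shows "branch par x (p @ [y])"
proof -
  have "par ((p @ [y]) ! Suc i) = (p @ [y]) ! i" if "Suc i < length (p @ [y])" for i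
  proof (cases "Suc i < length p")
    case True
    then show ?thesis using assms(1) by (simp add: branch_def nth_append)
  next
    case False
    then have "i = length p - 1" "p \<noteq> []" using that assms(1) by (auto simp: branch_def)
    then show ?thesis using assms(2) by (simp add: nth_append last_conv_nth)
  qed
  then show ?thesis using assms by (auto simp: branch_def)
qed

lemma grown_0:
  assumes "forest S r T par" "children T par x = 0"
  shows "grown S r T par x 0 {x} T par"
proof -
  have "branch par x [x]" by (simp add: branch_def)
  then have "\<exists>p. branch par x p \<and> set (tl p) \<subseteq> T - T \<and> last p = x \<and> length p = Suc 0"
    by (intro exI[of _ "[x]"]) simp
  then show ?thesis using assms by (simp add: grown_def)
qed

text \<open>Each vertex of the current level receives \<open>t\<close> children. A level consists of
  the root or of vertices outside \<open>S\<close>, which is exactly where the lower bound on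
  \<open>r\<close> is assumed. The new vertices are childless, as all parents lie in
  \<open>S\<close>, the old forest or the old level.\<close>

lemma grow:
  assumes g: "grown S r T0 par0 x j A T par" and x: "x \<in> S" and S: "S \<subseteq> V"
    and r: "\<And>v. v \<notin> S \<or> v = x \<Longrightarrow> t \<le> r v" "\<And>v. r v \<le> 6"
    and card: "card S + card T + t * card A + 13 * m \<le> card V"
  shows "\<exists>A' T' par'. grown S r T0 par0 x (Suc j) A' T' par' \<and> card A' = t * card A \<and>
           card T' = card T + t * card A"
proof -
  have T: "T \<subseteq> V - S" "\<forall>y\<in>T. y \<in> N (par y) \<and> par y \<in> S \<union> T" "good (S \<union> T) (\<lambda>v. r v - children T par v)"
    and g': "T0 \<subseteq> T" "\<forall>y\<in>T0. par y = par0 y" "\<forall>y\<in>T - T0. par y \<in> insert x (T - T0)"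
      "A \<subseteq> insert x (T - T0)" "\<forall>a\<in>A. children T par a = 0"
      "\<forall>a\<in>A. \<exists>p. branch par x p \<and> set (tl p) \<subseteq> T - T0 \<and> last p = a \<and> length p = Suc j"
    using g unfolding grown_def forest_def by auto
  have A: "A \<subseteq> V" using g'(4) x S T(1) by auto
  have fin: "finite A" "finite T" using finite_sub[OF A] finite_sub[of T] T(1) by auto
  have c1: "t \<le> r a - children T par a" if "a \<in> A" for a
  proof -
    have "a \<notin> S \<or> a = x" using that g'(4) T(1) by blast
    then show ?thesis using r(1)[of a] g'(5) that by simp
  qed
  have c2: "r v - children T par v \<le> 6" for v using r(2)[of v] by simp
  have c3: "S \<union> T \<subseteq> V" using S T(1) by blast
  have c4: "card (S \<union> T) + t * card A + 13 * m \<le> card V" using card card_Un_le[of S T] by linarith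
  have "\<exists>U q. U \<subseteq> V - (S \<union> T) \<and> (\<forall>y\<in>U. q y \<in> A \<and> y \<in> N (q y)) \<and>
      (\<forall>a\<in>A. card {y\<in>U. q y = a} = t) \<and>
      good (S \<union> T \<union> U) (\<lambda>v. if v \<in> A then r v - children T par v - t else r v - children T par v)"
    using extend_set[of A "S \<union> T" "\<lambda>v. r v - children T par v" t, OF fin(1) A T(3) c1 c2 c3 c4] .
  then obtain U q where U: "U \<subseteq> V - (S \<union> T)" "\<forall>y\<in>U. q y \<in> A \<and> y \<in> N (q y)"
      "\<forall>a\<in>A. card {y\<in>U. q y = a} = t"
      "good (S \<union> T \<union> U) (\<lambda>v. if v \<in> A then r v - children T par v - t else r v - children T par v)"
    by (elim exE conjE)
  define par' where "par' y = (if y \<in> U then q y else par y)" for y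
  have fU: "finite U" using U(1) finite_sub by auto
  have disj: "U \<inter> T = {}" "U \<inter> S = {}" using U(1) by auto
  have par'T: "par' y = par y" if "y \<in> T" for y using that disj by (auto simp: par'_def)
  have par'U: "par' y = q y" if "y \<in> U" for y using that by (auto simp: par'_def)
  have ch: "children (T \<union> U) par' v = children T par v + (if v \<in> A then t else 0)" for v
  proof -
    have "{y \<in> T \<union> U. par' y = v} = {y\<in>T. par y = v} \<union> {y\<in>U. q y = v}"
      using par'T par'U by auto
    moreover have "{y\<in>U. q y = v} = {}" if "v \<notin> A" using U(2) that by auto
    moreover have "card ({y\<in>T. par y = v} \<union> {y\<in>U. q y = v}) = card {y\<in>T. par y = v} + card {y\<in>U. q y = v}"
      using fin fU disj by (intro card_Un_disjoint) auto
    ultimately show ?thesis using U(3) unfolding children_def by (cases "v \<in> A") simp_all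
  qed
  have r_eq: "(\<lambda>v. if v \<in> A then r v - children T par v - t else r v - children T par v)
      = (\<lambda>v. r v - children (T \<union> U) par' v)" by (rule ext) (simp add: ch)
  have F: "forest S r (T \<union> U) par'"
    unfolding forest_def
  proof (intro conjI)
    show "T \<union> U \<subseteq> V - S" using T(1) U(1) by auto
    show "\<forall>y\<in>T \<union> U. y \<in> N (par' y) \<and> par' y \<in> S \<union> (T \<union> U)"
    proof
      fix y assume "y \<in> T \<union> U"
      then show "y \<in> N (par' y) \<and> par' y \<in> S \<union> (T \<union> U)"
      proof
        assume "y \<in> T"
        then show ?thesis using T(2) par'T[of y] by auto
      next
        assume y: "y \<in> U"
        then have "q y \<in> insert x (T - T0)" using U(2) g'(4) by blast
        then show ?thesis using x y U(2) par'U[of y] by auto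
      qed
    qed
    show "good (S \<union> (T \<union> U)) (\<lambda>v. r v - children (T \<union> U) par' v)"
      using U(4) unfolding r_eq Un_assoc .
  qed
  have cU: "card U = t * card A"
  proof -
    have "U = (\<Union>a\<in>A. {y\<in>U. q y = a})" using U(2) by auto
    then have "card U = card (\<Union>a\<in>A. {y\<in>U. q y = a})" by (rule arg_cong)
    also have "\<dots> = (\<Sum>a\<in>A. card {y\<in>U. q y = a})" using fin fU by (intro card_UN_disjoint) auto
    finally show ?thesis using U(3) by simp
  qed
  have lev: "children (T \<union> U) par' u = 0 \<and>
     (\<exists>p. branch par' x p \<and> set (tl p) \<subseteq> T \<union> U - T0 \<and> last p = u \<and> length p = Suc (Suc j))"
    if u: "u \<in> U" for u
  proof
    have "u \<notin> S" "u \<notin> T" using u disj by blast+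
    then have "u \<notin> A" using g'(4) x by blast
    moreover have "\<forall>y\<in>T. par y \<noteq> u"
      using T(2) \<open>u \<notin> S\<close> \<open>u \<notin> T\<close> by blast
    then have "{y\<in>T. par y = u} = {}" by blast
    then have "children T par u = 0" unfolding children_def by (simp only: card.empty)
    ultimately show "children (T \<union> U) par' u = 0" by (simp only: ch if_False add_0)
    have "q u \<in> A" using U(2) u by blast
    with g'(6) have "\<exists>p. branch par x p \<and> set (tl p) \<subseteq> T - T0 \<and> last p = q u \<and> length p = Suc j"
      by (rule bspec)
    then obtain p where p: "branch par x p" "set (tl p) \<subseteq> T - T0" "last p = q u" "length p = Suc j"
      by (elim exE conjE)
    have p': "p \<noteq> []" "hd p = x" using p(1) by (simp_all add: branch_def)
    have sp: "set p = insert x (set (tl p))" using p' by (cases p) simp_all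
    have "branch par' x p" using p(2) par'T by (intro branch_cong[OF p(1)]) blast
    moreover have "u \<noteq> x" "u \<notin> set (tl p)" using \<open>u \<notin> S\<close> \<open>u \<notin> T\<close> p(2) x by auto
    then have "u \<notin> set p" by (simp add: sp)
    ultimately have "branch par' x (p @ [u])" using par'U[OF u] p(3) by (intro branch_append) simp_all
    moreover have "set (tl (p @ [u])) \<subseteq> T \<union> U - T0"
      using p(2) p'(1) u \<open>u \<notin> T\<close> g'(1) by auto
    ultimately show "\<exists>p. branch par' x p \<and> set (tl p) \<subseteq> T \<union> U - T0 \<and> last p = u \<and> length p = Suc (Suc j)"
      using p(4) by (intro exI[of _ "p @ [u]"]) simp
  qed
  have "grown S r T0 par0 x (Suc j) U (T \<union> U) par'"
    unfolding grown_def
  proof (intro conjI)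
    show "forest S r (T \<union> U) par'" by (fact F)
    show "T0 \<subseteq> T \<union> U" using g' by auto
    show "\<forall>y\<in>T0. par' y = par0 y" using g'(1,2) par'T by auto
    show "\<forall>y\<in>T \<union> U - T0. par' y \<in> insert x (T \<union> U - T0)"

    proof
      fix y assume y: "y \<in> T \<union> U - T0"
      show "par' y \<in> insert x (T \<union> U - T0)"
      proof (cases "y \<in> U")
        case True
        then have "q y \<in> insert x (T - T0)" using U(2) g'(4) by blast
        then show ?thesis using True par'U by auto
      next
        case False
        then have "par y \<in> insert x (T - T0)" "y \<in> T" using y g'(3) by blast+
        then show ?thesis using par'T by auto
      qed
    qed
    show "U \<subseteq> insert x (T \<union> U - T0)" using g'(1) disj by auto
    show "\<forall>a\<in>U. children (T \<union> U) par' a = 0 \<and>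
       (\<exists>p. branch par' x p \<and> set (tl p) \<subseteq> T \<union> U - T0 \<and> last p = a \<and> length p = Suc (Suc j))"
      using lev by blast
  qed
  moreover note cU
  moreover have "card (T \<union> U) = card T + t * card A"
    using card_Un_disjoint[of T U, OF fin(2) fU] disj(1) cU by (simp add: Int_commute)
  ultimately have "grown S r T0 par0 x (Suc j) U (T \<union> U) par' \<and> card U = t * card A \<and>
      card (T \<union> U) = card T + t * card A" by (intro conjI)
  then show ?thesis by (intro exI)
qed

text \<open>One child per vertex lengthens the branches at constant width, three children triple the
  width. The bound with factor 2 survives a ternary step because 2 * 3^i + 3 * 3^i is at most 2 *
  3^(i+1).\<close>

lemma
  assumes g: "grown S r T0 par0 x j A T par" and x: "x \<in> S" and S: "S \<subseteq> V"
    and r: "\<And>v. v \<notin> S \<or> v = x \<Longrightarrow> 3 \<le> r v" "\<And>v. r v \<le> 6"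
  shows grow_path: "card S + card T + i * card A + 13 * m \<le> card V \<Longrightarrow>
      \<exists>A' T' par'. grown S r T0 par0 x (j + i) A' T' par' \<and> card A' = card A \<and> card T' = card T + i * card A"
    and grow_ternary: "card S + card T + 2 * 3 ^ i * card A + 13 * m \<le> card V \<Longrightarrow>
      \<exists>A' T' par'. grown S r T0 par0 x (j + i) A' T' par' \<and> card A' = 3 ^ i * card A \<and>
        card T' \<le> card T + 2 * 3 ^ i * card A"
proof (induction i)
  case 0
  {
    case 1
    then show ?case using g by - (rule exI[of _ A], rule exI[of _ T], rule exI[of _ par], simp)
  next
    case 2
    then show ?case using g by - (rule exI[of _ A], rule exI[of _ T], rule exI[of _ par], simp)
  }
next
  case (Suc i)
  {
    case 1
    then obtain A' T' par' where g': "grown S r T0 par0 x (j + i) A' T' par'" "card A' = card A"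
      "card T' = card T + i * card A"
      using Suc.IH(1) by auto
    have "1 \<le> r v" if "v \<notin> S \<or> v = x" for v using r(1)[OF that] by simp
    moreover have "card S + card T' + 1 * card A' + 13 * m \<le> card V" using 1 g' by simp
    ultimately obtain A2 T2 par2 where "grown S r T0 par0 x (Suc (j + i)) A2 T2 par2"
      "card A2 = 1 * card A'" "card T2 = card T' + 1 * card A'"
      using grow[OF g'(1) x S, of 1] r(2) by blast
    then show ?case using g'(2,3) by - (rule exI[of _ A2], rule exI[of _ T2], rule exI[of _ par2], simp)
  next
    case 2
    then obtain A' T' par' where g': "grown S r T0 par0 x (j + i) A' T' par'" "card A' = 3 ^ i * card A"
      "card T' \<le> card T + 2 * 3 ^ i * card A"
      using Suc.IH(2) by auto
    have "card S + card T' + 3 * card A' + 13 * m \<le> card V" using 2 g' by simp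
    then obtain A2 T2 par2 where "grown S r T0 par0 x (Suc (j + i)) A2 T2 par2"
      "card A2 = 3 * card A'" "card T2 = card T' + 3 * card A'"
      using grow[OF g'(1) x S, of 3] r by blast
    then show ?case using g'(2,3) by - (rule exI[of _ A2], rule exI[of _ T2], rule exI[of _ par2], simp add: algebra_simps)
  }
qed

lemma grow_tree:
  assumes f: "forest S r T par" "children T par x = 0" and x: "x \<in> S" and S: "S \<subseteq> V"
    and r: "\<And>v. v \<notin> S \<or> v = x \<Longrightarrow> 3 \<le> r v" "\<And>v. r v \<le> 6"
    and card: "card S + card T + j + 2 * 3 ^ q + 13 * m \<le> card V" and "q \<le> j"
  shows "\<exists>A' T' par'. grown S r T par x j A' T' par' \<and> card A' = 3 ^ q \<and>
           card T' \<le> card T + j + 2 * 3 ^ q"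
proof -
  have "card S + card T + (j - q) * card {x} + 13 * m \<le> card V" using card by simp
  from grow_path[OF grown_0[OF f] x S r this]
  obtain A1 T1 par1 where g1: "grown S r T par x (j - q) A1 T1 par1" "card A1 = 1"
     "card T1 = card T + (j - q)" by auto
  have "card S + card T1 + 2 * 3 ^ q * card A1 + 13 * m \<le> card V"
    unfolding g1(2,3) using card by linarith
  from grow_ternary[OF g1(1) x S r this] obtain A2 T2 par2
    where "grown S r T par x (j - q + q) A2 T2 par2" "card A2 = 3 ^ q" "card T2 \<le> card T1 + 2 * 3 ^ q"
    unfolding g1(2) mult_1_right by blast
  then show ?thesis using g1(3) \<open>q \<le> j\<close> by - (rule exI[of _ A2], rule exI[of _ T2], rule exI[of _ par2], simp)
qed

section \<open>Paths as vertex lists, and the linking of pairs\<close>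

definition link :: "'a list \<Rightarrow> 'a \<Rightarrow> 'a \<Rightarrow> bool" where
  "link p x y \<longleftrightarrow> p \<noteq> [] \<and> hd p = x \<and> last p = y \<and> distinct p \<and> set p \<subseteq> V \<and>
     (\<forall>i. Suc i < length p \<longrightarrow> p ! Suc i \<in> N (p ! i))"

lemma link_rev:
  assumes "link p x y" shows "link (rev p) y x"
proof -
  have "rev p ! Suc i \<in> N (rev p ! i)" if "Suc i < length p" for i
  proof -
    let ?k = "length p - Suc (Suc i)"
    have "p ! Suc ?k \<in> N (p ! ?k)" "p ! ?k \<in> V" using assms that nth_mem[of ?k p] by (auto simp: link_def)
    then have "p ! ?k \<in> N (p ! Suc ?k)" by (rule N_sym[rotated])
    moreover have "Suc ?k = length p - Suc i" using that by simp
    ultimately show ?thesis using that by (simp add: rev_nth)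
  qed
  then show ?thesis using assms by (auto simp: link_def hd_rev last_rev)
qed

lemma link_append:
  assumes p: "link p x u" and q: "link q w y" and "w \<in> N u" "set p \<inter> set q = {}"
  shows "link (p @ q) x y"
proof -
  have ne: "p \<noteq> []" "q \<noteq> []" using p q by (auto simp: link_def)
  have "(p @ q) ! Suc i \<in> N ((p @ q) ! i)" if i: "Suc i < length (p @ q)" for i
  proof -
    consider "Suc i < length p" | "Suc i = length p" | "length p \<le> i" by linarith
    then show ?thesis
    proof cases
      case 1
      then show ?thesis using p by (simp add: link_def nth_append)
    next
      case 2
      then have "(p @ q) ! Suc i = hd q" "i = length p - 1"
        using ne by (simp_all add: nth_append hd_conv_nth)
      moreover from this(2) have "(p @ q) ! i = last p"
        using ne by (simp add: nth_append last_conv_nth)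
      ultimately show ?thesis using p q assms(3) by (simp add: link_def)
    next
      case 3
      then have "Suc (i - length p) < length q" using i by simp
      then have "q ! Suc (i - length p) \<in> N (q ! (i - length p))" using q by (simp add: link_def)
      then show ?thesis using 3 by (simp add: nth_append Suc_diff_le)
    qed
  qed
  then show ?thesis using assms ne by (auto simp: link_def)
qed

lemma branch_link:
  assumes "branch par x p" "set (tl p) \<subseteq> T" "forest S r T par" "x \<in> V"
  shows "link p x (last p)"
proof -
  have p: "p \<noteq> []" "hd p = x" using assms(1) by (simp_all add: branch_def)
  have "set p = insert x (set (tl p))" using p by (cases p) simp_all
  moreover have "T \<subseteq> V" using assms(3) by (auto simp: forest_def)
  ultimately have sub: "set p \<subseteq> V" using assms(2,4) by auto
  have "p ! Suc i \<in> N (p ! i)" if i: "Suc i < length p" for i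
  proof -
    have "p ! Suc i \<in> set (tl p)" using i nth_mem[of i "tl p"] by (simp add: nth_tl)
    then have "p ! Suc i \<in> T" using assms(2) by blast
    then have "p ! Suc i \<in> N (par (p ! Suc i))" using assms(3) by (simp add: forest_def)
    then show ?thesis using assms(1) i by (simp add: branch_def)
  qed
  then show ?thesis using assms(1) sub by (simp add: link_def branch_def)
qed

lemma branch_closed:
  assumes "branch par x p" "v \<in> set (tl p)"
  shows "par v \<in> set p"
proof -
  obtain i where "i < length (tl p)" "v = tl p ! i" using assms(2) by (metis in_set_conv_nth)
  then have "Suc i < length p" "v = p ! Suc i" by (auto simp: nth_tl)
  then show ?thesis using assms(1) by (simp add: branch_def)
qed

text \<open>\<open>Z\<close> holds the vertices that will receive no more children; every other
  vertex keeps demand 3, enough to be a root or an inner vertex of a ternary tree. The conclusion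
  restores this invariant with the new path moved into \<open>Z\<close>, so links can be built one
  after another.\<close>

lemma find_link:
  fixes S Z :: "'a set"
  defines "r \<equiv> (\<lambda>v. if v \<in> Z then 0 else 3)"
  assumes good: "good S r" and S: "S \<subseteq> V" and Z: "Z \<subseteq> S"
    and xy: "x \<in> S - Z" "y \<in> S - Z" "x \<noteq> y"
    and q: "m \<le> 3 ^ q" "q \<le> a" "q \<le> b"
    and card: "card S + a + b + 4 * 3 ^ q + 13 * m \<le> card V"
  shows "\<exists>P. link P x y \<and> length P = a + b + 2 \<and> set P \<inter> S = {x, y} \<and>
           good (S \<union> set P) (\<lambda>v. if v \<in> Z \<union> set P then 0 else 3)"
proof -
  have r6: "r v \<le> 6" for v by (simp add: r_def)
  have r3x: "3 \<le> r v" if "v \<notin> S \<or> v = x" for v using that Z xy by (auto simp: r_def)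
  have r3y: "3 \<le> r v" if "v \<notin> S \<or> v = y" for v using that Z xy by (auto simp: r_def)
  have f0: "forest S r {} id" using good by (simp add: forest_def children_def)
  have c0: "children {} id x = 0" by (simp add: children_def)
  have s0: "card S + card ({} :: 'a set) + a + 2 * 3 ^ q + 13 * m \<le> card V" using card by simp
  have xS: "x \<in> S" and yS: "y \<in> S" using xy by simp_all
  have "\<exists>A' T' par'. grown S r {} id x a A' T' par' \<and> card A' = 3 ^ q \<and>
      card T' \<le> card ({} :: 'a set) + a + 2 * 3 ^ q"
    by (rule grow_tree[OF f0 c0 xS S _ r6 s0 q(2)]) (rule r3x)
  then obtain A1 T1 par1 where g1: "grown S r {} id x a A1 T1 par1" "card A1 = 3 ^ q"
    "card T1 \<le> card ({} :: 'a set) + a + 2 * 3 ^ q"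
    by (elim exE conjE)
  have f1: "forest S r T1 par1" using g1(1) by (simp add: grown_def)
  have T1: "T1 \<subseteq> V - S" using f1 by (simp add: forest_def)
  \<comment> \<open>Parents in the first tree are \<open>x\<close> or tree vertices, so
    \<open>y\<close> still has its full demand when the second tree starts.\<close>
  have "\<forall>v\<in>T1. par1 v \<in> insert x T1" using g1(1) by (simp add: grown_def)
  moreover have "y \<notin> insert x T1" using xy T1 by blast
  ultimately have "{v\<in>T1. par1 v = y} = {}" by blast
  then have c1: "children T1 par1 y = 0" unfolding children_def by (simp only: card.empty)
  have s1: "card S + card T1 + b + 2 * 3 ^ q + 13 * m \<le> card V" using card g1(3) by simp
  have "\<exists>A' T' par'. grown S r T1 par1 y b A' T' par' \<and> card A' = 3 ^ q \<and>
      card T' \<le> card T1 + b + 2 * 3 ^ q"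
    by (rule grow_tree[OF f1 c1 yS S _ r6 s1 q(3)]) (rule r3y)
  then obtain A2 T2 par2 where g2: "grown S r T1 par1 y b A2 T2 par2" "card A2 = 3 ^ q"
    by (elim exE conjE)
  have f2: "forest S r T2 par2" using g2(1) by (simp add: grown_def)
  have T2: "T2 \<subseteq> V - S" "\<forall>v\<in>T2. v \<in> N (par2 v)" "good (S \<union> T2) (\<lambda>v. r v - children T2 par2 v)"
    using f2 by (simp_all add: forest_def)
  have A: "A1 \<subseteq> insert x T1" "A2 \<subseteq> insert y (T2 - T1)" using g1(1) g2(1) by (simp_all add: grown_def)
  have "x \<in> V" "y \<in> V" using xy S by auto
  then have "A1 \<subseteq> V" "A2 \<subseteq> V" using A T1 T2(1) by blast+
  then obtain u w where uw: "u \<in> A1" "w \<in> A2" "w \<in> N u" using joined[of A1 A2] q(1) g1(2) g2(2) by auto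
  have "\<exists>p. branch par1 x p \<and> set (tl p) \<subseteq> T1 - {} \<and> last p = u \<and> length p = Suc a"
    using g1(1) uw(1) unfolding grown_def by blast
  then obtain p where p: "branch par1 x p" "set (tl p) \<subseteq> T1" "last p = u" "length p = Suc a"
    by (metis Diff_empty)
  have "\<exists>p. branch par2 y p \<and> set (tl p) \<subseteq> T2 - T1 \<and> last p = w \<and> length p = Suc b"
    using g2(1) uw(2) unfolding grown_def by blast
  then obtain q' where q': "branch par2 y q'" "set (tl q') \<subseteq> T2 - T1" "last q' = w" "length q' = Suc b"
    by (elim exE conjE)
  have T12: "T1 \<subseteq> T2" "\<forall>v\<in>T1. par2 v = par1 v" using g2(1) by (simp_all add: grown_def)
  have p2: "branch par2 x p" using T12(2) p(2) by (intro branch_cong[OF p(1)]) blast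
  have lp: "link p x u" using branch_link[OF p2 _ f2 \<open>x \<in> V\<close>] p(2,3) T12(1) by auto
  have lq: "link q' y w" using branch_link[OF q'(1) _ f2 \<open>y \<in> V\<close>] q'(2,3) by auto
  have ne: "p \<noteq> []" "hd p = x" "q' \<noteq> []" "hd q' = y" using p(1) q'(1) by (simp_all add: branch_def)
  have sp: "set p = insert x (set (tl p))" using ne by (cases p) simp_all
  have sq: "set q' = insert y (set (tl q'))" using ne by (cases q') simp_all
  define Q where "Q = set (tl p) \<union> set (tl q')"
  have QT: "Q \<subseteq> T2" using p(2) q'(2) T12(1) by (auto simp: Q_def)
  have setP: "set (p @ rev q') = {x, y} \<union> Q" using sp sq by (auto simp: Q_def)
  have disj: "set p \<inter> set q' = {}"
  proof -
    have "set p \<subseteq> insert x T1" "set q' \<subseteq> insert y (T2 - T1)"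
      unfolding sp sq using p(2) q'(2) by blast+
    moreover have "x \<notin> T2" "y \<notin> T1" using T1 T2(1) xy by blast+
    ultimately show ?thesis using xy(3) by blast
  qed
  have "link (p @ rev q') x y" using link_append[OF lp link_rev[OF lq] uw(3)] disj by simp
  moreover have "length (p @ rev q') = a + b + 2" using p(4) q'(4) by simp
  moreover have "set (p @ rev q') \<inter> S = {x, y}" unfolding setP using QT T2(1) xy by blast
  moreover have "good (S \<union> set (p @ rev q')) (\<lambda>v. if v \<in> Z \<union> set (p @ rev q') then 0 else 3)"
  proof (rule good_mono)
    \<comment> \<open>All vertices of both trees that are off the path are rolled back at
      once.\<close>
    let ?R = "T2 - Q"
    show "good (S \<union> T2 - ?R) (\<lambda>v. r v - children T2 par2 v + card {z \<in> ?R. par2 z = v})"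
      using T2 S by (intro rollback) auto
    show "S \<union> set (p @ rev q') \<subseteq> S \<union> T2 - ?R" unfolding setP using QT T2(1) xy by blast
    fix v
    show "(if v \<in> Z \<union> set (p @ rev q') then 0 else 3) \<le> r v - children T2 par2 v + card {z \<in> ?R. par2 z = v}"
    proof (cases "v \<in> Z \<union> set (p @ rev q')")
      case False
      \<comment> \<open>The path is closed under taking parents. So every tree child of a vertex off
        the path is rolled back too, and that vertex regains its whole demand.\<close>
      have "par2 z \<noteq> v" if "z \<in> Q" for z
      proof -
        have "par2 z \<in> set p \<union> set q'"
          using that branch_closed[OF p2] branch_closed[OF q'(1)] by (auto simp: Q_def)
        then show ?thesis using False by auto
      qed
      then have "{z \<in> ?R. par2 z = v} = {z \<in> T2. par2 z = v}" by blast
      then have "card {z \<in> ?R. par2 z = v} = children T2 par2 v" by (simp only: children_def)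
      then show ?thesis using False by (simp add: r_def)
    qed simp
  qed
  ultimately show ?thesis by (intro exI[of _ "p @ rev q'"] conjI)
qed

text \<open>After its rollback a link occupies only \<open>a + b + 2\<close> vertices. The cost
  \<open>4 * 3 ^ q\<close> of the auxiliary trees therefore enters the budget once and not once per
  pair.\<close>

lemma find_links:
  assumes "finite I" and "good S (\<lambda>v. if v \<in> Z then 0 else 3)" and "S \<subseteq> V" and "Z \<subseteq> S"
    and "x ` I \<union> y ` I \<subseteq> S - Z" and "inj_on x I" "inj_on y I" "x ` I \<inter> y ` I = {}"
    and q: "m \<le> 3 ^ q" "q \<le> a" "q \<le> b"
    and "card S + card I * (a + b + 2) + a + b + 4 * 3 ^ q + 13 * m \<le> card V"
  shows "\<exists>P. (\<forall>i\<in>I. link (P i) (x i) (y i) \<and> length (P i) = a + b + 2 \<and> set (P i) \<inter> S = {x i, y i}) \<and>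
           (\<forall>i\<in>I. \<forall>j\<in>I. i \<noteq> j \<longrightarrow> set (P i) \<inter> set (P j) = {})"
  using assms(1-8,12)
proof (induction I arbitrary: S Z)
  case empty
  then show ?case by simp
next
  case (insert i I)
  have i: "x i \<in> S - Z" "y i \<in> S - Z" "x i \<noteq> y i" using insert.prems(4,7) by auto
  have c: "card S + a + b + 4 * 3 ^ q + 13 * m \<le> card V" using insert.prems(8) by linarith
  obtain p where p: "link p (x i) (y i)" "length p = a + b + 2" "set p \<inter> S = {x i, y i}"
     "good (S \<union> set p) (\<lambda>v. if v \<in> Z \<union> set p then 0 else 3)"
    using find_link[OF insert.prems(1,2,3) i q c] by (elim exE conjE)
  have new: "x j \<notin> {x i, y i}" "y j \<notin> {x i, y i}" if "j \<in> I" for j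
  proof -
    have "j \<noteq> i" using that insert.hyps by auto
    then have "x j \<noteq> x i" "y j \<noteq> y i"
      using inj_onD[OF insert.prems(5), of j i] inj_onD[OF insert.prems(6), of j i] that by auto
    moreover have "x j \<noteq> y i" "y j \<noteq> x i"
      using insert.prems(7) imageI[OF insertI1, of x i I] imageI[OF insertI1, of y i I]
        imageI[OF insertI2, OF that, of x i] imageI[OF insertI2, OF that, of y i]
      by (metis IntI empty_iff)+
    ultimately show "x j \<notin> {x i, y i}" "y j \<notin> {x i, y i}" by simp_all
  qed
  have "\<exists>P. (\<forall>j\<in>I. link (P j) (x j) (y j) \<and> length (P j) = a + b + 2 \<and> set (P j) \<inter> (S \<union> set p) = {x j, y j}) \<and>
           (\<forall>i\<in>I. \<forall>j\<in>I. i \<noteq> j \<longrightarrow> set (P i) \<inter> set (P j) = {})"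
  proof (rule insert.IH[OF p(4)])
    show "S \<union> set p \<subseteq> V" using p(1) insert.prems(2) by (auto simp: link_def)
    show "Z \<union> set p \<subseteq> S \<union> set p" using insert.prems(3) by auto
    show "x ` I \<union> y ` I \<subseteq> S \<union> set p - (Z \<union> set p)"
      using insert.prems(4) new p(3) by blast
    show "inj_on x I" "inj_on y I" using insert.prems(5,6) by (auto intro: inj_on_subset)
    show "x ` I \<inter> y ` I = {}" using insert.prems(7) by auto
    have "card (S \<union> set p) \<le> card S + (a + b + 2)"
      using card_Un_le[of S "set p"] card_length[of p] p(2) by simp
    then show "card (S \<union> set p) + card I * (a + b + 2) + a + b + 4 * 3 ^ q + 13 * m \<le> card V"
      using insert.prems(8) insert.hyps by simp
  qed
  then obtain P where P: "\<forall>j\<in>I. link (P j) (x j) (y j) \<and> length (P j) = a + b + 2 \<and> set (P j) \<inter> (S \<union> set p) = {x j, y j}"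
     "\<forall>i\<in>I. \<forall>j\<in>I. i \<noteq> j \<longrightarrow> set (P i) \<inter> set (P j) = {}" by (elim exE conjE)
  have d: "set p \<inter> set (P j) = {}" "set (P j) \<inter> S = {x j, y j}" if "j \<in> I" for j
  proof -
    have e: "set (P j) \<inter> (S \<union> set p) = {x j, y j}" using P(1) that by blast
    moreover have "x j \<in> S" "y j \<in> S" using insert.prems(4) that by auto
    ultimately have "x j \<notin> set p" "y j \<notin> set p" using p(3) new[OF that] by blast+
    moreover have "set p \<inter> set (P j) \<subseteq> {x j, y j}" using e by blast
    ultimately show "set p \<inter> set (P j) = {}" by auto
    show "set (P j) \<inter> S = {x j, y j}" using e \<open>x j \<in> S\<close> \<open>y j \<in> S\<close> by blast
  qed
  let ?P = "P(i := p)"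
  have eq: "?P j = P j" if "j \<in> I" for j using that insert.hyps by auto
  have "\<forall>j\<in>insert i I. link (?P j) (x j) (y j) \<and> length (?P j) = a + b + 2 \<and> set (?P j) \<inter> S = {x j, y j}"
    using p P(1) d(2) eq by simp
  moreover have "\<forall>j\<in>insert i I. \<forall>k\<in>insert i I. j \<noteq> k \<longrightarrow> set (?P j) \<inter> set (?P k) = {}"
  proof (intro ballI impI)
    fix j k assume jk: "j \<in> insert i I" "k \<in> insert i I" "j \<noteq> k"
    then consider "j = i" "k \<in> I" | "k = i" "j \<in> I" | "j \<in> I" "k \<in> I" by blast
    then show "set (?P j) \<inter> set (?P k) = {}"
    proof cases
      case 1
      then show ?thesis using d(1)[of k] eq[of k] by simp
    next
      case 2
      then show ?thesis using d(1)[of j] eq[of j] by (simp add: Int_commute)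
    next
      case 3
      then show ?thesis using P(2) eq jk(3) by simp
    qed
  qed
  ultimately show ?case by (intro exI[of _ ?P] conjI)
qed

end

section \<open>Choosing the stars\<close>

text \<open>\<gamma> stands for lam / d. The assumption \<open>expand\<close> is the mixing lemma in
  the form used below: few vertices can send a proportion \<delta> of their edges into a small set.
  It is applied with \<delta> equal to 1, 1/2, 1/4 and \<eta>/4.\<close>

locale star_setting = joined_graph V N m for V :: "'a set" and N m +
  fixes d :: nat and \<gamma> \<eta> :: real
  assumes irrefl: "v \<in> V \<Longrightarrow> v \<notin> N v"
    and regular: "v \<in> V \<Longrightarrow> card (N v) = d"
    and expand: "\<lbrakk>X \<subseteq> V; Y \<subseteq> V; 0 < \<delta>; \<And>x. x \<in> X \<Longrightarrow> \<delta> * real d \<le> real (card (N x \<inter> Y)); 2 * real (card Y) \<le> \<delta> * real (card V)\<rbrakk>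
        \<Longrightarrow> \<delta>\<^sup>2 * real (card X) \<le> 4 * \<gamma>\<^sup>2 * real (card Y)"
    and eta: "0 < \<eta>" "\<eta> < 1/2" and gamma: "0 \<le> \<gamma>" "\<gamma> \<le> \<eta>\<^sup>2 / 2048"
    and m_small: "48 * m \<le> card V" and d_small: "8 * (real d * real d + real d) \<le> \<eta> * real (card V)"
begin

lemma gamma_sq: "\<gamma>\<^sup>2 \<le> \<eta> ^ 4 / 4194304"
proof -
  have "\<gamma>\<^sup>2 \<le> (\<eta>\<^sup>2 / 2048)\<^sup>2" using gamma by (intro power_mono) auto
  then show ?thesis by (simp add: power_divide flip: power_mult)
qed

lemma eta_pow: "\<eta> ^ 2 \<le> 1" "\<eta> ^ 3 \<le> 1" "\<eta> ^ 4 \<le> 1"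
  using eta by (auto intro!: power_le_one)

lemma d_small': "16 * (d * d) + 16 * d \<le> card V"
proof -
  have "8 * (real d * real d + real d) \<le> 1/2 * real (card V)"
    using d_small mult_right_mono[of \<eta> "1/2" "real (card V)"] eta by linarith
  then have "real (16 * (d * d) + 16 * d) \<le> real (card V)" by simp
  then show ?thesis by linarith
qed

text \<open>A single vertex sends all its edges into its own neighbourhood, so \<open>expand\<close>
  with \<delta> = 1 gives 1 <= 4 \<gamma>^2 d. A small eigenvalue ratio thus forces a large degree;
  1000 is a convenient weakening.\<close>

lemma d_large: "1000 \<le> d"
proof -
  have "V \<noteq> {}" using m_small m_pos by auto
  then obtain v where v: "v \<in> V" by blast
  have "1\<^sup>2 * real (card {v}) \<le> 4 * \<gamma>\<^sup>2 * real (card (N v))"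
  proof (rule expand)
    show "2 * real (card (N v)) \<le> 1 * real (card V)" using regular[OF v] d_small' by simp
  qed (use v N_subset regular in auto)
  also have "\<dots> \<le> 4 * (1 / 4194304) * real d"
    using regular[OF v] gamma_sq eta_pow by (intro mult_mono) auto
  finally show ?thesis by simp
qed

text \<open>Every vertex of \<open>X\<close> sends at least half of its edges to the free neighbours
  of \<open>X\<close>. If these are few, \<open>expand\<close> makes them far more numerous than
  \<open>X\<close>; otherwise they form more than a quarter of \<open>V\<close>, and
  \<open>48 * m\<close> is chosen so that a quarter is at least 6 * 2 m.\<close>

lemma expand_six:
  assumes X: "X \<subseteq> V" "card X \<le> 2 * m" and T: "\<And>x. x \<in> X \<Longrightarrow> 2 * card (N x \<inter> T) \<le> d"
  shows "6 * card X \<le> card (Nbs X - T)"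
proof (cases "2 * real (card (Nbs X - T)) \<le> 1/2 * real (card V)")
  case True
  have "(1/2)\<^sup>2 * real (card X) \<le> 4 * \<gamma>\<^sup>2 * real (card (Nbs X - T))"
  proof (rule expand[OF X(1) _ _ _ True])
    show "Nbs X - T \<subseteq> V" using Nbs_subset[OF X(1)] by auto
    fix x assume x: "x \<in> X"
    then have xV: "x \<in> V" using X(1) by auto
    have "finite (N x)" using N_subset[OF xV] by (rule finite_sub)
    then have "card (N x \<inter> T) + card (N x - T) = d"
      using card_Int_Diff[of "N x" T] regular[OF xV] by simp
    moreover have "N x \<inter> (Nbs X - T) = N x - T" using x by auto
    ultimately have "d \<le> 2 * card (N x \<inter> (Nbs X - T))" using T[OF x] by simp
    then show "1/2 * real d \<le> real (card (N x \<inter> (Nbs X - T)))" by linarith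
  qed simp
  also have "\<dots> \<le> 4 * (1 / 4194304) * real (card (Nbs X - T))"
    using gamma_sq eta_pow by (intro mult_right_mono mult_left_mono) auto
  finally have "real (6 * card X) \<le> real (card (Nbs X - T))" by (simp add: power2_eq_square)
  then show ?thesis by linarith
next
  case False
  then have "card V < 4 * card (Nbs X - T)" by linarith
  then show ?thesis using X(2) m_small by linarith
qed

text \<open>
  The last condition prevents a vertex from losing most of its neighbours to the centres themselves;
  the neighbourhoods of the centres may still swallow all neighbours of some vertices (for instance of
  twins of a centre).
\<close>

definition centres :: "nat \<Rightarrow> (nat \<Rightarrow> 'a) \<Rightarrow> bool" where
  "centres i c \<longleftrightarrow> c ` {..<i} \<subseteq> V \<and>
     (\<forall>j<i. real (card (N (c j) \<inter> Nbs (c ` {..<j}))) \<le> \<eta> * real d / 4) \<and>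
     (\<forall>j<i. \<forall>l<j. c j \<noteq> c l \<and> c j \<notin> N (c l)) \<and>
     (\<forall>v\<in>V. 2 * card (N v \<inter> c ` {..<i}) \<le> d)"

lemma card_Nbs_le:
  assumes "X \<subseteq> V" shows "card (Nbs X) \<le> card X * d"
proof -
  have "card (Nbs X) \<le> (\<Sum>x\<in>X. card (N x))" using finite_sub[OF assms] by (rule card_UN_le)
  also have "\<dots> = card X * d" using assms regular by (simp add: subset_iff)
  finally show ?thesis .
qed

text \<open>The next centre must avoid \<open>C\<close>, its neighbourhood, the vertices
  \<open>X1\<close> with too large an overlap, and the neighbours of \<open>X2\<close>. Each of
  these sets has at most d^2 vertices, while \<open>V\<close> has at least 16 d^2.\<close>

lemma centres_Suc:
  assumes c: "centres i c" and "i < d"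
  shows "\<exists>x. centres (Suc i) (c(i := x))"
proof -
  define C where "C = c ` {..<i}"
  have CV: "C \<subseteq> V" using c by (simp add: centres_def C_def)
  have cC: "card C \<le> d" using card_image_le[of "{..<i}" c] assms(2) by (simp add: C_def)
  have "card (Nbs C) \<le> card C * d" by (rule card_Nbs_le[OF CV])
  also have "\<dots> \<le> d * d" using cC by simp
  finally have cW: "card (Nbs C) \<le> d * d" .
  then have cW': "real (card (Nbs C)) \<le> real d * real d" by (metis of_nat_le_iff of_nat_mult)
  have WV: "Nbs C \<subseteq> V" by (rule Nbs_subset[OF CV])
  define X1 where "X1 = {v \<in> V. \<eta> * real d / 4 < real (card (N v \<inter> Nbs C))}"
  \<comment> \<open>The \<open>+ 2\<close> singles out the vertices for which one more adjacent
    centre would break the last condition of \<open>centres\<close>.\<close>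
  define X2 where "X2 = {v \<in> V. d < 2 * card (N v \<inter> C) + 2}"
  have "(\<eta>/4)\<^sup>2 * real (card X1) \<le> 4 * \<gamma>\<^sup>2 * real (card (Nbs C))"
  proof (rule expand)
    have "8 * (real d * real d) \<le> \<eta> * real (card V)" using d_small by simp
    then show "2 * real (card (Nbs C)) \<le> \<eta> / 4 * real (card V)" using cW' by linarith
  qed (use WV eta in \<open>auto simp: X1_def\<close>)
  also have "\<dots> \<le> 4 * (\<eta> ^ 4 / 4194304) * real (card (Nbs C))"
    using gamma_sq by (intro mult_right_mono mult_left_mono) auto
  also have "\<dots> = (\<eta>/4)\<^sup>2 * (\<eta>\<^sup>2 / 65536 * real (card (Nbs C)))"
    by (simp add: power_divide power2_eq_square power4_eq_xxxx)
  finally have "real (card X1) \<le> \<eta>\<^sup>2 / 65536 * real (card (Nbs C))" using eta by simp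
  also have "\<dots> \<le> 1 * real (card (Nbs C))" using eta_pow by (intro mult_right_mono) auto
  finally have cX1: "card X1 \<le> d * d" using cW by simp
  have "(1/4)\<^sup>2 * real (card X2) \<le> 4 * \<gamma>\<^sup>2 * real (card C)"
  proof (rule expand)
    have "8 * card C \<le> card V" using cC d_small' by linarith
    then show "2 * real (card C) \<le> 1 / 4 * real (card V)" by linarith
    fix v assume "v \<in> X2"
    then have "d < 2 * card (N v \<inter> C) + 2" by (simp add: X2_def)
    then have "d \<le> 4 * card (N v \<inter> C)" using d_large by linarith
    then show "1 / 4 * real d \<le> real (card (N v \<inter> C))" by linarith
  qed (use CV in \<open>auto simp: X2_def\<close>)
  also have "\<dots> \<le> 4 * (1 / 4194304) * real (card C)"
    using gamma_sq eta_pow by (intro mult_right_mono mult_left_mono) auto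
  finally have cX2: "card X2 \<le> d" using cC by (simp add: power2_eq_square)
  have X2V: "X2 \<subseteq> V" by (auto simp: X2_def)
  have "card (Nbs X2) \<le> card X2 * d" by (rule card_Nbs_le[OF X2V])
  also have "\<dots> \<le> d * d" using cX2 by simp
  finally have cX2': "card (Nbs X2) \<le> d * d" .
  let ?F = "C \<union> Nbs C \<union> X1 \<union> Nbs X2"
  have "card ?F \<le> card C + card (Nbs C) + card X1 + card (Nbs X2)"
    using card_Un_le[of "C \<union> Nbs C \<union> X1" "Nbs X2"] card_Un_le[of "C \<union> Nbs C" X1] card_Un_le[of C "Nbs C"] by linarith
  then have "card ?F < card V" using cC cW cX1 cX2' d_small' d_large by linarith
  then have "\<not> V \<subseteq> ?F" using card_mono[of ?F V] CV WV X2V finite_sub[of ?F] Nbs_subset[OF X2V]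
    by (auto simp: X1_def)
  then obtain x where x: "x \<in> V" "x \<notin> C" "x \<notin> Nbs C" "x \<notin> X1" "x \<notin> Nbs X2" by blast
  have im: "(c(i := x)) ` {..<j} = c ` {..<j}" if "j \<le> i" for j using that by auto
  have im': "(c(i := x)) ` {..<Suc i} = insert x C" by (auto simp: C_def lessThan_Suc)
  have "centres (Suc i) (c(i := x))"
    unfolding centres_def
  proof (intro conjI allI ballI impI)
    show "(c(i := x)) ` {..<Suc i} \<subseteq> V" unfolding im' using x CV by simp
  next
    fix j assume "j < Suc i"
    then show "real (card (N ((c(i := x)) j) \<inter> Nbs ((c(i := x)) ` {..<j}))) \<le> \<eta> * real d / 4"
      using c x(1,4) im[of j] by (cases "j = i") (auto simp: centres_def X1_def C_def)
  next
    fix j l assume "j < Suc i" "l < j"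
    then show "(c(i := x)) j \<noteq> (c(i := x)) l" "(c(i := x)) j \<notin> N ((c(i := x)) l)"
      using c x(2,3) by (cases "j = i"; auto simp: centres_def C_def)+
  next
    fix v assume v: "v \<in> V"
    show "2 * card (N v \<inter> (c(i := x)) ` {..<Suc i}) \<le> d"
    proof (cases "x \<in> N v")
      case True
      then have "v \<notin> X2" using x by auto
      then have "2 * card (N v \<inter> C) + 2 \<le> d" using v by (simp add: X2_def)
      moreover have "card (N v \<inter> insert x C) \<le> card (N v \<inter> C) + 1"
        using True finite_sub[OF CV] by (simp add: card_insert_if)
      ultimately show ?thesis unfolding im' by linarith
    next
      case False
      then have "N v \<inter> insert x C = N v \<inter> C" by auto
      then show ?thesis unfolding im' using c v by (simp add: centres_def C_def)
    qed
  qed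
  then show ?thesis by blast
qed

lemma ex_centres: "i \<le> d \<Longrightarrow> \<exists>c. centres i c"
proof (induction i)
  case 0
  then show ?case by (simp add: centres_def)
next
  case (Suc i)
  then show ?case using centres_Suc[of i] by (meson Suc_le_eq less_imp_le)
qed

text \<open>
  The vertices in \<open>B\<close> own six private neighbours in \<open>U\<close> each, the other vertices expand by a factor
  of six: whichever part of \<open>X\<close> is the larger one alone provides \<open>3 * card X\<close> neighbours.
\<close>

lemma good_avoiding:
  assumes P: "\<And>b. b \<in> B \<Longrightarrow> card {y\<in>U. par y = b} = 6" "\<And>y. y \<in> U \<Longrightarrow> y \<in> N (par y)"
    and U: "U \<inter> S = {}" "U \<subseteq> V"
    and T: "\<And>x. x \<in> V \<Longrightarrow> x \<notin> B \<Longrightarrow> 2 * card (N x \<inter> T) \<le> d" and S: "S \<subseteq> T"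
  shows "good S (\<lambda>_. 3)"
  unfolding good_def
proof (intro allI impI)
  fix X assume X: "X \<subseteq> V" "card X \<le> 2 * m"
  have fin: "finite X" "finite U" "finite (Nbs X)"
    using finite_sub[OF X(1)] finite_sub[OF U(2)] finite_Nbs[OF X(1)] .
  have "6 * card (X \<inter> B) = (\<Sum>b\<in>X \<inter> B. card {y\<in>U. par y = b})" using P(1) by simp
  also have "\<dots> = card (\<Union>b\<in>X \<inter> B. {y\<in>U. par y = b})"
    using fin by (intro card_UN_disjoint[symmetric]) auto
  also have "\<dots> \<le> card (Nbs X - S)" using fin P(2) U(1) by (intro card_mono) auto
  finally have "6 * card (X \<inter> B) \<le> card (Nbs X - S)" .
  moreover have "6 * card (X - B) \<le> card (Nbs (X - B) - T)"
  proof (rule expand_six)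
    show "card (X - B) \<le> 2 * m" using X(2) card_mono[OF fin(1), of "X - B"] by auto
  qed (use X(1) T in auto)
  then have "6 * card (X - B) \<le> card (Nbs X - S)"
    using card_mono[of "Nbs X - S" "Nbs (X - B) - T"] fin S by fastforce
  moreover have "card X = card (X \<inter> B) + card (X - B)" using card_Int_Diff[OF fin(1)] .
  ultimately show "(\<Sum>_\<in>X. 3) \<le> card (Nbs X - S)" by simp
qed

text \<open>The fraction \<eta> is spent as follows: a kept centre loses at most \<eta> d / 4
  neighbours to earlier centres and \<eta> d / 4 to the reserved set \<open>U\<close>, and at most
  \<eta> d / 2 centres are dropped. So at least \<open>k\<close> centres with at least
  \<open>k\<close> leaves each remain.\<close>

lemma ex_stars:
  assumes k: "real k \<le> (1 - \<eta>) * real d"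
  shows "\<exists>c f. inj_on c {..<k} \<and> c ` {..<k} \<subseteq> V \<and> inj_on (case_prod f) ({..<k} \<times> {..<k}) \<and>
     (\<forall>i<k. \<forall>j<k. f i j \<in> N (c i) \<and> f i j \<notin> c ` {..<k}) \<and>
     good (c ` {..<k} \<union> case_prod f ` ({..<k} \<times> {..<k})) (\<lambda>_. 3)"
proof -
  obtain c where c: "centres d c" using ex_centres by blast
  define C where "C = c ` {..<d}"
  define W where "W = Nbs C"
  \<comment> \<open>Removing the neighbourhoods of earlier centres only is enough to make the sets
    \<open>L j\<close> pairwise disjoint.\<close>
  define L where "L j = N (c j) - Nbs (c ` {..<j})" for j
  have cV: "c j \<in> V" if "j < d" for j using c that by (auto simp: centres_def)
  have CV: "C \<subseteq> V" using cV by (auto simp: C_def)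
  have cC: "card C \<le> d" using card_image_le[of "{..<d}" c] by (simp add: C_def)
  have "card W \<le> card C * d" unfolding W_def by (rule card_Nbs_le[OF CV])
  also have "\<dots> \<le> d * d" using cC by simp
  finally have cW: "card W \<le> d * d" .
  have WV: "W \<subseteq> V" unfolding W_def by (rule Nbs_subset[OF CV])
  have cT: "card (W \<union> C) \<le> d * d + d" using card_Un_le[of W C] cW cC by linarith
  have ne: "c j \<noteq> c l" "c j \<notin> N (c l)" if "l < j" "j < d" for l j
    using c that by (auto simp: centres_def)
  have injc: "inj_on c {..<d}" using ne by (intro inj_onI) (metis lessThan_iff linorder_neqE_nat)
  have indep: "c j \<notin> N (c l)" if "j < d" "l < d" for j l
  proof (cases j l rule: linorder_cases)
    case less
    then have "c l \<notin> N (c j)" using ne that by auto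
    then show ?thesis using N_sym[OF cV[OF \<open>l < d\<close>]] by blast
  qed (use ne that irrefl[OF cV] in auto)
  have LW: "L j \<subseteq> W" if "j < d" for j using that by (auto simp: L_def W_def C_def)
  have Ldisj: "L j \<inter> L l = {}" if "j \<noteq> l" for j l
  proof (cases "j < l")
    case True
    then have "L j \<subseteq> Nbs (c ` {..<l})" by (auto simp: L_def)
    then show ?thesis by (auto simp: L_def)
  next
    case False
    then have "L l \<subseteq> Nbs (c ` {..<j})" using that by (auto simp: L_def)
    then show ?thesis by (auto simp: L_def)
  qed
  have cL: "real d - \<eta> * real d / 4 \<le> real (card (L j))" if "j < d" for j
  proof -
    have "finite (N (c j))" using N_subset[OF cV[OF that]] by (rule finite_sub)
    then have "card (N (c j) \<inter> Nbs (c ` {..<j})) + card (L j) = d"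
      using card_Int_Diff[of "N (c j)" "Nbs (c ` {..<j})"] regular[OF cV[OF that]] by (simp add: L_def)
    moreover have "real (card (N (c j) \<inter> Nbs (c ` {..<j}))) \<le> \<eta> * real d / 4"
      using c that by (simp add: centres_def)
    ultimately show ?thesis by linarith
  qed
  \<comment> \<open>\<open>B\<close> is measured against all neighbours of all \<open>d\<close>
    centres: its reserved neighbours must be fixed before the leaves, which have to avoid
    them.\<close>
  define B where "B = {v \<in> V. d < 2 * card (N v \<inter> (W \<union> C))}"
  have BV: "B \<subseteq> V" by (auto simp: B_def)
  have "(1/2)\<^sup>2 * real (card B) \<le> 4 * \<gamma>\<^sup>2 * real (card (W \<union> C))"
  proof (rule expand)
    have "4 * card (W \<union> C) \<le> card V" using cT d_small' by linarith
    then show "2 * real (card (W \<union> C)) \<le> 1 / 2 * real (card V)" by linarith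
    fix v assume "v \<in> B"
    then have "d \<le> 2 * card (N v \<inter> (W \<union> C))" by (simp add: B_def)
    then show "1 / 2 * real d \<le> real (card (N v \<inter> (W \<union> C)))" by linarith
  qed (use CV WV BV in auto)
  also have "\<dots> \<le> 4 * (\<eta> ^ 4 / 4194304) * real (d * d + d)"
    using gamma_sq of_nat_mono[OF cT, where 'a = real] by (intro mult_mono) auto
  finally have cB: "real (card B) \<le> \<eta> ^ 4 / 262144 * real (d * d + d)" by (simp add: power2_eq_square)
  also have "\<dots> \<le> 1 * real (d * d + d)" using eta_pow by (intro mult_right_mono) simp_all
  finally have cB': "card B \<le> d * d + d" unfolding mult_1 of_nat_le_iff .
  \<comment> \<open>By the last condition on centres each vertex keeps half of its neighbours
    outside \<open>C\<close>, so demand 6 is available to reserve neighbours for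
    \<open>B\<close>.\<close>
  have "good C (\<lambda>_. 6)"
    unfolding good_def
  proof (intro allI impI)
    fix X assume X: "X \<subseteq> V" "card X \<le> 2 * m"
    then have "6 * card X \<le> card (Nbs X - C)" using c by (intro expand_six) (auto simp: centres_def C_def)
    then show "(\<Sum>_\<in>X. 6) \<le> card (Nbs X - C)" by simp
  qed
  moreover have "card C + 6 * card B + 13 * m \<le> card V"
    using cC cB' d_small' m_small by linarith
  ultimately have "\<exists>U par. U \<subseteq> V - C \<and> (\<forall>y\<in>U. par y \<in> B \<and> y \<in> N (par y)) \<and>
      (\<forall>a\<in>B. card {y\<in>U. par y = a} = 6) \<and> good (C \<union> U) (\<lambda>v. if v \<in> B then 6 - 6 else 6)"
    using extend_set[OF finite_sub[OF BV] BV, of C "\<lambda>_. 6" 6] CV by blast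
  then obtain U par where U: "U \<subseteq> V - C" "\<forall>y\<in>U. par y \<in> B \<and> y \<in> N (par y)"
      "\<forall>b\<in>B. card {y\<in>U. par y = b} = 6" by (elim exE conjE)
  have fB: "finite B" and fU: "finite U" using finite_sub[OF BV] finite_sub[of U] U(1) by auto
  have "U = (\<Union>b\<in>B. {y\<in>U. par y = b})" using U(2) by auto
  then have "card U = card (\<Union>b\<in>B. {y\<in>U. par y = b})" by (rule arg_cong)
  also have "\<dots> = (\<Sum>b\<in>B. card {y\<in>U. par y = b})" using fB fU by (intro card_UN_disjoint) auto
  finally have cU: "card U = 6 * card B" using U(3) by simp
  define D where "D = {j. j < d \<and> \<eta> * real d / 4 < real (card (L j \<inter> U))}"
  have fD: "finite D" by (simp add: D_def)
  \<comment> \<open>Double counting: the sets \<open>L j\<close> are disjoint and \<open>U\<close>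
    has size O(\<eta>^4 d^2), so \<open>U\<close> meets only few of them in more than \<eta> d / 4
    vertices.\<close>
  have "real (card D) * (\<eta> * real d / 4) \<le> (\<Sum>j\<in>D. real (card (L j \<inter> U)))"
    using sum_bounded_below[of D "\<eta> * real d / 4" "\<lambda>j. real (card (L j \<inter> U))"] by (auto simp: D_def)
  also have "\<dots> = real (card (\<Union>j\<in>D. L j \<inter> U))"
    using fD fU Ldisj by (subst card_UN_disjoint) auto
  also have "\<dots> \<le> real (card U)" using fU by (intro of_nat_mono card_mono) auto
  also have "\<dots> \<le> 6 * (\<eta> ^ 4 / 262144 * real (d * d + d))" using cB cU by simp
  also have "\<dots> \<le> 6 * (\<eta> ^ 4 / 262144 * (2 * (real d * real d)))"
    using d_large by (intro mult_left_mono) (auto simp: mult_mono)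
  also have "\<dots> = (\<eta> ^ 2 * (96 / 262144)) * (\<eta> * real d / 2) * (\<eta> * real d / 4)"
    by (simp add: power2_eq_square power4_eq_xxxx)
  also have "\<dots> \<le> 1 * (\<eta> * real d / 2) * (\<eta> * real d / 4)"
    using eta eta_pow by (intro mult_right_mono) auto
  finally have cD: "real (card D) \<le> \<eta> * real d / 2" using eta d_large by simp
  define J where "J = {..<d} - D"
  have "card J = d - card D" unfolding J_def by (subst card_Diff_subset) (auto simp: D_def)
  moreover have "real k + real (card D) \<le> real d"
    using k cD eta d_large by (simp add: algebra_simps)
  ultimately have kJ: "k \<le> card J" by linarith
  obtain J' where J': "J' \<subseteq> J" "card J' = k" using obtain_subset_with_card_n[OF kJ] by blast
  then have "finite J'" using finite_subset[of J' "{..<d}"] by (auto simp: J_def)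
  then obtain g where g: "bij_betw g {..<k} J'"
    using J'(2) finite_same_card_bij[of "{..<k}" J'] by auto
  have gd: "g i < d" "g i \<notin> D" if "i < k" for i
    using bij_betwE[OF g] J'(1) that by (auto simp: J_def)
  have "\<exists>h. inj_on h {..<k} \<and> h ` {..<k} \<subseteq> L (g i) - U" if "i < k" for i
  proof -
    have fL: "finite (L (g i))" using finite_sub[OF WV] LW[OF gd(1)[OF that]] finite_subset by blast
    have "card (L (g i) \<inter> U) + card (L (g i) - U) = card (L (g i))"
      using card_Int_Diff[OF fL, of U] by simp
    moreover have "real (card (L (g i) \<inter> U)) \<le> \<eta> * real d / 4" using gd[OF that] by (simp add: D_def)
    moreover have "real k + \<eta> * real d \<le> real d" "0 \<le> \<eta> * real d" using k eta by (simp_all add: algebra_simps)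
    ultimately have "k \<le> card (L (g i) - U)" using cL[OF gd(1)[OF that]] by linarith
    then obtain L' where "L' \<subseteq> L (g i) - U" "card L' = k" "finite L'"
      using obtain_subset_with_card_n by metis
    moreover then obtain h where "bij_betw h {..<k} L'"
      using finite_same_card_bij[of "{..<k}" L'] by auto
    ultimately show ?thesis by (auto simp: bij_betw_def)
  qed
  then obtain f where f: "\<And>i. i < k \<Longrightarrow> inj_on (f i) {..<k} \<and> f i ` {..<k} \<subseteq> L (g i) - U" by metis
  have fL: "f i j \<in> L (g i)" "f i j \<notin> U" if "i < k" "j < k" for i j using f[OF that(1)] that(2) by auto
  have injg: "inj_on g {..<k}" using g by (simp add: bij_betw_def)
  let ?c = "c \<circ> g"
  have cC': "?c ` {..<k} \<subseteq> C" using gd by (auto simp: C_def)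
  have fC: "f i j \<notin> C" if "i < k" "j < k" for i j
  proof -
    have "f i j \<in> N (c (g i))" using fL(1)[OF that] by (simp add: L_def)
    then show ?thesis using indep[OF _ gd(1)[OF that(1)]] by (auto simp: C_def)
  qed
  have injf: "i = i' \<and> j = j'" if ij: "i < k" "j < k" "i' < k" "j' < k" "f i j = f i' j'" for i j i' j'
  proof -
    have "f i j \<in> L (g i) \<inter> L (g i')" using fL(1)[of i j] fL(1)[of i' j'] ij by auto
    then have "g i = g i'" using Ldisj[of "g i" "g i'"] by auto
    then have "i = i'" using inj_onD[OF injg] ij by auto
    then show ?thesis using f[of i] ij by (auto dest: inj_onD)
  qed
  show ?thesis
  proof (intro exI conjI)
    show "inj_on ?c {..<k}"
      using injg injc gd by (intro comp_inj_on) (auto intro: inj_on_subset)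
    show "?c ` {..<k} \<subseteq> V" using cC' CV by simp
    show "inj_on (case_prod f) ({..<k} \<times> {..<k})"
      using injf by (auto simp: inj_on_def)
    show "\<forall>i<k. \<forall>j<k. f i j \<in> N (?c i) \<and> f i j \<notin> ?c ` {..<k}"
    proof (intro allI impI conjI)
      fix i j assume ij: "i < k" "j < k"
      show "f i j \<in> N (?c i)" using fL(1)[OF ij] by (simp add: L_def)
      show "f i j \<notin> ?c ` {..<k}" using fC[OF ij] cC' by blast
    qed
    show "good (?c ` {..<k} \<union> case_prod f ` ({..<k} \<times> {..<k})) (\<lambda>_. 3)"
    proof (rule good_avoiding[where B = B and U = U and par = par and T = "W \<union> C"])
      show "card {y\<in>U. par y = b} = 6" if "b \<in> B" for b using U(3) that by simp
      show "y \<in> N (par y)" if "y \<in> U" for y using U(2) that by simp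
      show "U \<inter> (?c ` {..<k} \<union> case_prod f ` ({..<k} \<times> {..<k})) = {}"
        using U(1) cC' fL(2) by auto
      show "U \<subseteq> V" using U(1) by auto
      show "2 * card (N x \<inter> (W \<union> C)) \<le> d" if "x \<in> V" "x \<notin> B" for x using that by (simp add: B_def)
      show "?c ` {..<k} \<union> case_prod f ` ({..<k} \<times> {..<k}) \<subseteq> W \<union> C"
      proof (rule Un_mono[of _ C _ W, unfolded Un_commute[of C W]])
        show "case_prod f ` ({..<k} \<times> {..<k}) \<subseteq> W"
        proof clarify
          fix i j assume "i < k" "j < k"
          then show "f i j \<in> W" using fL(1)[of i j] LW[OF gd(1)[of i]] by blast
        qed
      qed (rule cC')
    qed
  qed
qed

text \<open>The leaf \<open>f i j\<close> of centre i is reserved for centre j: for i < j the link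
  runs from \<open>f i j\<close> to \<open>f j i\<close>, so no leaf is used twice. The leaves
  \<open>f i i\<close> end no link but count as used, so links avoid them.\<close>

lemma ex_linked_stars:
  assumes k: "real k \<le> (1 - \<eta>) * real d" and q: "m \<le> 3 ^ q" "q \<le> a" "q \<le> b"
    and card: "d + d * d + d * d * (a + b + 2) + a + b + 4 * 3 ^ q + 13 * m \<le> card V"
  shows "\<exists>c Q. inj_on c {..<k} \<and> c ` {..<k} \<subseteq> V \<and>
     (\<forall>i j. i < j \<and> j < k \<longrightarrow> link (c i # Q i j @ [c j]) (c i) (c j) \<and>
        length (Q i j) = a + b + 2 \<and> set (Q i j) \<inter> c ` {..<k} = {}) \<and>
     (\<forall>i j i' j'. i < j \<and> j < k \<and> i' < j' \<and> j' < k \<and> (i, j) \<noteq> (i', j') \<longrightarrow>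
        set (Q i j) \<inter> set (Q i' j') = {})"
proof -
  obtain c f where cf: "inj_on c {..<k}" "c ` {..<k} \<subseteq> V" "inj_on (case_prod f) ({..<k} \<times> {..<k})"
     "\<forall>i<k. \<forall>j<k. f i j \<in> N (c i) \<and> f i j \<notin> c ` {..<k}"
     "good (c ` {..<k} \<union> case_prod f ` ({..<k} \<times> {..<k})) (\<lambda>_. 3)"
    using ex_stars[OF k] by blast
  let ?Z = "c ` {..<k}" and ?L = "case_prod f ` ({..<k} \<times> {..<k})"
  let ?x = "case_prod f" and ?y = "\<lambda>(i, j). f j i"
  define I where "I = {(i, j). i < j \<and> j < k}"
  have IK: "I \<subseteq> {..<k} \<times> {..<k}" by (auto simp: I_def)
  have fI: "finite I" using IK finite_subset by blast
  have kd: "k \<le> d"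
  proof -
    have "(1 - \<eta>) * real d \<le> 1 * real d" using eta by (intro mult_right_mono) auto
    then show ?thesis using k by simp
  qed
  have kk: "k * k \<le> d * d" using kd by (intro mult_mono) auto
  have cI: "card I \<le> d * d"
    using card_mono[OF _ IK] kk by simp
  have cL: "card ?L \<le> d * d" using card_image_le[of "{..<k} \<times> {..<k}" "case_prod f"] kk by simp
  have cZ: "card ?Z \<le> d" using card_image_le[of "{..<k}" c] kd by simp
  have LV: "?L \<subseteq> V"
  proof clarify
    fix i j assume "i < k" "j < k"
    then show "f i j \<in> V" using cf(2,4) N_subset[of "c i"] by blast
  qed
  have inj: "i = i' \<and> j = j'" if "i < k" "j < k" "i' < k" "j' < k" "f i j = f i' j'" for i j i' j'
    using inj_onD[OF cf(3), of "(i, j)" "(i', j')"] that by auto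
  have yL: "?y ` I \<subseteq> ?L"
  proof clarify
    fix i j assume "(i, j) \<in> I"
    then have "(j, i) \<in> {..<k} \<times> {..<k}" by (auto simp: I_def)
    then show "f j i \<in> ?L" by (metis (mono_tags) case_prod_conv imageI)
  qed
  have LZ: "?L \<inter> ?Z = {}" using cf(4) by auto
  have "\<exists>P. (\<forall>i\<in>I. link (P i) (?x i) (?y i) \<and> length (P i) = a + b + 2 \<and> set (P i) \<inter> (?Z \<union> ?L) = {?x i, ?y i}) \<and>
           (\<forall>i\<in>I. \<forall>j\<in>I. i \<noteq> j \<longrightarrow> set (P i) \<inter> set (P j) = {})"
  proof (rule find_links[where Z = ?Z, OF fI])
    \<comment> \<open>The centres already have their leaves and get demand 0; the leaves keep demand
      3, as trees will be rooted there.\<close>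
    show "good (?Z \<union> ?L) (\<lambda>v. if v \<in> ?Z then 0 else 3)" by (rule good_mono[OF cf(5)]) auto
    show "?Z \<union> ?L \<subseteq> V" using cf(2) LV by blast
    show "?Z \<subseteq> ?Z \<union> ?L" by blast
    show "?x ` I \<union> ?y ` I \<subseteq> ?Z \<union> ?L - ?Z" using yL image_mono[OF IK, of ?x] LZ by blast
    show "inj_on ?x I" using cf(3) IK by (rule inj_on_subset)
    show "inj_on ?y I"
    proof (rule inj_onI)
      fix p p' assume p: "p \<in> I" "p' \<in> I" "?y p = ?y p'"
      obtain i j i' j' where "p = (i, j)" "p' = (i', j')" by (cases p, cases p')
      then show "p = p'" using p inj[of j i j' i'] by (auto simp: I_def)
    qed
    show "?x ` I \<inter> ?y ` I = {}"
    proof -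
      have "?x p \<noteq> ?y p'" if "p \<in> I" "p' \<in> I" for p p'
      proof -
        obtain i j i' j' where "p = (i, j)" "p' = (i', j')" by (cases p, cases p')
        then show ?thesis using that inj[of i j j' i'] by (auto simp: I_def)
      qed
      then show ?thesis by blast
    qed
    have "card (?Z \<union> ?L) \<le> d + d * d" using card_Un_le[of ?Z ?L] cZ cL by linarith
    moreover have "card I * (a + b + 2) \<le> d * d * (a + b + 2)" using cI by (rule mult_right_mono) simp
    ultimately show "card (?Z \<union> ?L) + card I * (a + b + 2) + a + b + 4 * 3 ^ q + 13 * m \<le> card V"
      using card by linarith
  qed (use q in auto)
  then obtain P where P: "\<forall>p\<in>I. link (P p) (?x p) (?y p) \<and> length (P p) = a + b + 2 \<and> set (P p) \<inter> (?Z \<union> ?L) = {?x p, ?y p}"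
     "\<forall>p\<in>I. \<forall>p'\<in>I. p \<noteq> p' \<longrightarrow> set (P p) \<inter> set (P p') = {}" by (elim exE conjE)
  let ?Q = "\<lambda>i j. P (i, j)"
  have main: "link (c i # ?Q i j @ [c j]) (c i) (c j) \<and> length (?Q i j) = a + b + 2 \<and> set (?Q i j) \<inter> ?Z = {}"
    if ij: "i < j" "j < k" for i j
  proof -
    have ijI: "(i, j) \<in> I" using ij by (simp add: I_def)
    then have p: "link (?Q i j) (f i j) (f j i)" "length (?Q i j) = a + b + 2"
      "set (?Q i j) \<inter> (?Z \<union> ?L) = {f i j, f j i}" using P(1)[rule_format, OF ijI] by simp_all
    have e: "f i j \<in> N (c i)" "f j i \<in> N (c j)" "f i j \<notin> ?Z" "f j i \<notin> ?Z" using cf(4) ij by auto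
    have disj: "set (?Q i j) \<inter> ?Z = {}"
    proof (rule equals0I)
      fix z assume z: "z \<in> set (?Q i j) \<inter> ?Z"
      then have "z \<in> {f i j, f j i}" "z \<in> ?Z" using p(3) by blast+
      then show False using e(3,4) by (metis empty_iff insert_iff)
    qed
    have cV: "c i \<in> V" "c j \<in> V" "c i \<in> ?Z" "c j \<in> ?Z" using cf(2) ij by auto
    have ne: "c i \<noteq> c j" using inj_onD[OF cf(1), of i j] ij by auto
    have l: "link [c i] (c i) (c i)" "link [c j] (c j) (c j)" using cV by (simp_all add: link_def)
    have "c j \<in> N (f j i)" using N_sym[OF cV(2) e(2)] .
    moreover have "set (?Q i j) \<inter> set [c j] = {}" using disj cV by auto
    ultimately have "link (?Q i j @ [c j]) (f i j) (c j)" by (rule link_append[OF p(1) l(2)])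
    moreover have "set [c i] \<inter> set (?Q i j @ [c j]) = {}" using disj cV ne by auto
    ultimately have "link ([c i] @ (?Q i j @ [c j])) (c i) (c j)" by (rule link_append[OF l(1) _ e(1)])
    then show ?thesis using p(2) disj by simp
  qed
  have "set (?Q i j) \<inter> set (?Q i' j') = {}" if "i < j" "j < k" "i' < j'" "j' < k" "(i, j) \<noteq> (i', j')" for i j i' j'
    using P(2) that by (auto simp: I_def)
  then show ?thesis using cf(1,2) main by (intro exI[of _ c] exI[of _ ?Q]) simp
qed

end

section \<open>Subdivisions\<close>

text \<open>Two sets without an edge between them satisfy |A| |B| <= (\<gamma> n)^2 by mixing, and
  \<gamma> n < m by the lower bound on \<open>m\<close>; this gives joinedness.\<close>

lemma ndlambda_star_setting:
  fixes \<eta> lam :: real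
  assumes G: "ndlambda_graph n d lam E" and lam: "0 \<le> lam" "2048 * lam / \<eta>\<^sup>2 < real d"
    and eta: "0 < \<eta>" "\<eta> < 1/2" and n: "0 < n"
    and m: "\<eta>\<^sup>2 * real n / 2048 \<le> real m" "1 \<le> m" "48 * m \<le> n"
    and d_small: "8 * (real d * real d + real d) \<le> \<eta> * real n"
  shows "star_setting {..<n} (\<lambda>v. {u. u < n \<and> E v u}) m d (lam / real d) \<eta>"
proof -
  define N where "N v = {u. u < n \<and> E v u}" for v
  have N_eq: "(\<lambda>v. {u. u < n \<and> E v u}) = N" by (simp add: N_def fun_eq_iff)
  have d: "0 < real d" using lam eta by (smt (verit) divide_nonneg_pos zero_less_power mult_nonneg_nonneg)
  define \<gamma> where "\<gamma> = lam / real d"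
  have e2: "0 < \<eta>\<^sup>2" "\<eta>\<^sup>2 \<le> 1" using eta by (auto intro: power_le_one)
  have lam': "lam < \<eta>\<^sup>2 / 2048 * real d" using lam(2) e2 by (simp add: field_simps)
  also have "\<dots> \<le> 1 * real d" using e2 by (intro mult_right_mono) auto
  finally have lam_d: "lam < real d" by simp
  have gamma: "0 \<le> \<gamma>" "\<gamma> < \<eta>\<^sup>2 / 2048" using lam' lam d by (auto simp: \<gamma>_def divide_less_eq)
  have lam_eq: "lam = \<gamma> * real d" using d by (simp add: \<gamma>_def)
  have mix: "((\<Sum>x\<in>X. real (card (N x \<inter> Y))) - real d * real (card X) * real (card Y) / real n)\<^sup>2
     \<le> lam\<^sup>2 * real (card X) * real (card Y)" if "X \<subseteq> {..<n}" "Y \<subseteq> {..<n}" for X Y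
    using expander_mixing[OF G lam(1) lam_d n that] unfolding N_def .
  have simple: "simple_graph_on n E" using G by (simp add: ndlambda_graph_def)
  show ?thesis unfolding N_eq \<gamma>_def[symmetric]
  proof
    show "finite {..<n}" by simp
    show "N v \<subseteq> {..<n}" for v by (auto simp: N_def)
    show "u \<in> N v" if "u \<in> {..<n}" "v \<in> N u" for u v
      using that simple by (auto simp: N_def simple_graph_on_def)
    show "1 \<le> m" by fact
    fix A B assume AB: "A \<subseteq> {..<n}" "B \<subseteq> {..<n}" "m \<le> card A" "m \<le> card B"
    show "\<exists>a\<in>A. \<exists>b\<in>B. b \<in> N a"
    proof (rule ccontr)
      assume "\<not> ?thesis"
      then have "N x \<inter> B = {}" if "x \<in> A" for x using that by blast
      then have "(\<Sum>x\<in>A. real (card (N x \<inter> B))) = 0" by (simp cong: sum.cong)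
      then have "(real d * real (card A) * real (card B) / real n)\<^sup>2 \<le> lam\<^sup>2 * real (card A) * real (card B)"
        using mix[OF AB(1,2)] by simp
      then have "(real d)\<^sup>2 * (real (card A) * real (card B))\<^sup>2 \<le> (real d)\<^sup>2 * ((\<gamma> * real n)\<^sup>2 * (real (card A) * real (card B)))"
        using n unfolding lam_eq by (simp add: power_divide power_mult_distrib divide_le_eq mult_ac)
      then have "(real (card A) * real (card B))\<^sup>2 \<le> (\<gamma> * real n)\<^sup>2 * (real (card A) * real (card B))"
        using d by simp
      moreover have pos: "0 < real (card A) * real (card B)" using AB m(2) by simp
      ultimately have "real (card A) * real (card B) \<le> (\<gamma> * real n)\<^sup>2"
        unfolding power2_eq_square[of "real (card A) * real (card B)"] by (rule mult_right_le_imp_le)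
      moreover have "real m * real m \<le> real (card A) * real (card B)" using AB by (intro mult_mono) auto
      moreover have "\<gamma> * real n < real m"
      proof -
        have "\<gamma> * real n < \<eta>\<^sup>2 / 2048 * real n" using gamma n by (intro mult_strict_right_mono) auto
        then show ?thesis using m(1) by simp
      qed
      then have "(\<gamma> * real n)\<^sup>2 < (real m)\<^sup>2" using gamma by (intro power_strict_mono) auto
      ultimately show False by (simp add: power2_eq_square)
    qed
  next
    show "v \<notin> N v" if "v \<in> {..<n}" for v using that simple by (auto simp: N_def simple_graph_on_def)
    show "card (N v) = d" if "v \<in> {..<n}" for v
      using that G by (simp add: N_def ndlambda_graph_def degree_on_def)
  next
    fix X Y and \<delta> :: real
    assume X: "X \<subseteq> {..<n}" and Y: "Y \<subseteq> {..<n}" and \<delta>: "0 < \<delta>"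
      and deg: "\<And>x. x \<in> X \<Longrightarrow> \<delta> * real d \<le> real (card (N x \<inter> Y))"
      and small: "2 * real (card Y) \<le> \<delta> * real (card {..<n})"
    let ?x = "real (card X)" and ?y = "real (card Y)"
    let ?e = "\<Sum>x\<in>X. real (card (N x \<inter> Y))"
    have "?x * (\<delta> * real d) \<le> ?e" using sum_bounded_below[of X "\<delta> * real d"] deg by simp
    \<comment> \<open>Since \<open>Y\<close> is small, the expected number of edges is at most half
      of those present. The other half is deviation, which is the origin of the factor 4 in
      \<open>expand\<close>.\<close>
    moreover have "real d * ?x * ?y / real n \<le> real d * ?x * (\<delta> / 2)"
    proof -
      have "?y / real n \<le> \<delta> / 2" using small n by (simp add: field_simps)
      then have "real d * ?x * (?y / real n) \<le> real d * ?x * (\<delta> / 2)" by (intro mult_left_mono) auto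
      then show ?thesis by simp
    qed
    ultimately have "?x * (\<delta> * real d) / 2 \<le> ?e - real d * ?x * ?y / real n" by (simp add: mult_ac)
    then have "(?x * (\<delta> * real d) / 2)\<^sup>2 \<le> (?e - real d * ?x * ?y / real n)\<^sup>2"
      using \<delta> by (intro power_mono) auto
    also have "\<dots> \<le> lam\<^sup>2 * ?x * ?y" by (rule mix[OF X Y])
    finally have "(?x * (real d)\<^sup>2) * (\<delta>\<^sup>2 * ?x) \<le> (?x * (real d)\<^sup>2) * (4 * \<gamma>\<^sup>2 * ?y)"
      unfolding lam_eq by (simp add: power_divide power_mult_distrib power2_eq_square mult_ac)
    then show "\<delta>\<^sup>2 * ?x \<le> 4 * \<gamma>\<^sup>2 * ?y"
      using d by (cases "card X = 0") simp_all
  next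
    show "0 < \<eta>" "\<eta> < 1/2" "0 \<le> \<gamma>" "\<gamma> \<le> \<eta>\<^sup>2 / 2048" using eta gamma by auto
    show "48 * m \<le> card {..<n}" "8 * (real d * real d + real d) \<le> \<eta> * real (card {..<n})"
      using m d_small by auto
  qed
qed

text \<open>These say that the graph is large, that d^2 is small against n, and that d^2 links of
  logarithmic length fit into half of the vertices. Here the slack \<epsilon> in the exponent beats
  the constant and the logarithm.\<close>

lemma eventually_parameters:
  fixes \<epsilon> \<eta> :: real
  assumes "0 < \<epsilon>" "0 < \<eta>"
  shows "\<forall>\<^sub>F n :: nat in sequentially. 100000 \<le> \<eta>\<^sup>2 * real n"
    "\<forall>\<^sub>F n :: nat in sequentially. 16 * real n powr (1 - 2 * \<epsilon>) \<le> \<eta> * real n"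
    "\<forall>\<^sub>F n :: nat in sequentially. real n powr (1 - 2 * \<epsilon>) * (4 * ln (real n) + 20) \<le> real n / 2"
proof -
  show "\<forall>\<^sub>F n :: nat in sequentially. 100000 \<le> \<eta>\<^sup>2 * real n" using assms by real_asymp
  show "\<forall>\<^sub>F n :: nat in sequentially. 16 * real n powr (1 - 2 * \<epsilon>) \<le> \<eta> * real n" using assms by real_asymp
  show "\<forall>\<^sub>F n :: nat in sequentially. real n powr (1 - 2 * \<epsilon>) * (4 * ln (real n) + 20) \<le> real n / 2"
    using assms by real_asymp
qed

theorem theorem3:
  fixes \<epsilon> \<eta> :: real
  assumes "\<epsilon> > 0" and "0 < \<eta>" and "\<eta> < 1/2"
  shows "\<exists>N. \<forall>n \<ge> N. \<forall>(d::nat) (lam::real) (E :: nat \<Rightarrow> nat \<Rightarrow> bool).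
           ndlambda_graph n d lam E \<and> 2048 * lam / \<eta>^2 < real d \<and>
           real d \<le> \<eta> * real n powr (1/2 - \<epsilon>) \<longrightarrow>
           has_Kk_l_subdivision n E (nat \<lfloor>(1 - \<eta>) * real d\<rfloor>)
             (nat (2 * \<lceil>ln (\<eta>^2 * real n / 4096)\<rceil> + 5))"
proof -
  note eta = assms(2,3)
  have "\<forall>\<^sub>F n :: nat in sequentially. 100000 \<le> \<eta>\<^sup>2 * real n \<and>
      16 * real n powr (1 - 2 * \<epsilon>) \<le> \<eta> * real n \<and>
      real n powr (1 - 2 * \<epsilon>) * (4 * ln (real n) + 20) \<le> real n / 2"
    using eventually_parameters[OF assms(1,2)] by eventually_elim auto
  then obtain n0 where n0: "\<And>n. n0 \<le> n \<Longrightarrow> 100000 \<le> \<eta>\<^sup>2 * real n \<and>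
      16 * real n powr (1 - 2 * \<epsilon>) \<le> \<eta> * real n \<and>
      real n powr (1 - 2 * \<epsilon>) * (4 * ln (real n) + 20) \<le> real n / 2"
    unfolding eventually_sequentially by blast
  show ?thesis
  proof (intro exI[of _ n0] allI impI, elim conjE)
    fix n d lam E
    assume n: "n0 \<le> n" and G: "ndlambda_graph n d lam E" and lam: "2048 * lam / \<eta>\<^sup>2 < real d"
      and d_le: "real d \<le> \<eta> * real n powr (1/2 - \<epsilon>)"
    have n_large: "100000 \<le> \<eta>\<^sup>2 * real n" and n1: "16 * real n powr (1 - 2 * \<epsilon>) \<le> \<eta> * real n"
      and n2: "real n powr (1 - 2 * \<epsilon>) * (4 * ln (real n) + 20) \<le> real n / 2" using n0[OF n] by auto
    have e2: "0 < \<eta>\<^sup>2" "\<eta>\<^sup>2 \<le> 1/4" using eta power_mono[of \<eta> "1/2" 2] by (auto simp: power2_eq_square)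
    have e2n: "\<eta>\<^sup>2 * real n \<le> 1/4 * real n" using e2 by (intro mult_right_mono) auto
    then have n_pos: "100000 \<le> real n" using n_large by linarith
    have lam0: "0 \<le> lam"
    proof -
      obtain evs :: "real list" where "\<forall>i. 1 \<le> i \<and> i < n \<longrightarrow> \<bar>evs ! i\<bar> \<le> lam"
        using G by (auto simp: ndlambda_graph_def)
      then have "\<bar>evs ! 1\<bar> \<le> lam" using n_pos by auto
      then show ?thesis by linarith
    qed
    have d_pos: "1 \<le> d"
    proof -
      have "0 \<le> 2048 * lam / \<eta>\<^sup>2" using lam0 by simp
      then show ?thesis using lam by linarith
    qed
    have dd: "real d * real d \<le> real n powr (1 - 2 * \<epsilon>)"
    proof -
      have "\<eta> * real n powr (1/2 - \<epsilon>) \<le> 1 * real n powr (1/2 - \<epsilon>)"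
        using eta by (intro mult_right_mono) auto
      then have "real d \<le> real n powr (1/2 - \<epsilon>)" using d_le by simp
      then have "real d * real d \<le> real n powr (1/2 - \<epsilon>) * real n powr (1/2 - \<epsilon>)" by (intro mult_mono) auto
      then show ?thesis by (simp flip: powr_add)
    qed
    have d_sq: "real d \<le> real d * real d" using d_pos by simp
    define x where "x = \<eta>\<^sup>2 * real n / 4096"
    have x: "20 \<le> x" "x \<le> real n / 16384" using n_large e2n unfolding x_def by linarith+
    define m where "m = nat \<lceil>2 * x\<rceil>"
    have m: "2 * x \<le> real m" "real m \<le> 2 * x + 1" using x unfolding m_def by linarith+
    have m1: "1 \<le> m" using m x by linarith
    define h where "h = nat \<lceil>ln x\<rceil>"
    have ln_x: "0 \<le> ln x" "ln x \<le> ln (real n)" using x by auto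
    have h: "ln x \<le> real h" "real h \<le> ln (real n) + 1" "int h = \<lceil>ln x\<rceil>"
      using ln_x unfolding h_def by linarith+
    \<comment> \<open>x <= e^h <= 3^h, and one further level pays for m <= 2 x + 1 <= 3 x.\<close>
    have m_le: "m \<le> 3 ^ (h + 1)"
    proof -
      have "x = exp (ln x)" using x by simp
      also have "\<dots> \<le> exp (real h)" using h by simp
      also have "\<dots> = exp 1 ^ h" by (simp flip: exp_of_nat_mult)
      also have "\<dots> \<le> 3 ^ h" using exp_le by (intro power_mono) auto
      finally have "real m \<le> real (3 ^ (h + 1))" using m x by simp
      then show ?thesis by (simp only: of_nat_le_iff)
    qed
    \<comment> \<open>The least exponent keeps \<open>3 ^ q\<close> below 3 m, whereas
      \<open>3 ^ h\<close> may exceed n.\<close>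
    define q where "q = (LEAST q. m \<le> 3 ^ q)"
    have q: "m \<le> 3 ^ q" "q \<le> h + 1" using m_le unfolding q_def by (rule LeastI Least_le)+
    have q3: "3 ^ q \<le> 3 * m"
    proof (cases q)
      case 0
      then show ?thesis using m1 by simp
    next
      case (Suc q')
      then have "\<not> m \<le> 3 ^ q'" using not_less_Least[of q' "\<lambda>q. m \<le> 3 ^ q"] by (simp add: q_def)
      then show ?thesis using Suc by simp
    qed
    have d_small: "8 * (real d * real d + real d) \<le> \<eta> * real n"
      unfolding distrib_left using d_sq dd n1 by linarith
    define N where "N v = {u. u < n \<and> E v u}" for v
    have m_real: "48 * real m \<le> real n" using m(2) x n_pos by linarith
    interpret star_setting "{..<n}" N m d "lam / real d" \<eta>
      unfolding N_def
    proof (rule ndlambda_star_setting[OF G lam0 lam eta])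
      show "0 < n" using n_pos by auto
      show "\<eta>\<^sup>2 * real n / 2048 \<le> real m" using m(1) unfolding x_def by linarith
      show "1 \<le> m" by fact
      show "48 * m \<le> n" using m_real by linarith
      show "8 * (real d * real d + real d) \<le> \<eta> * real n" by fact
    qed
    define k where "k = nat \<lfloor>(1 - \<eta>) * real d\<rfloor>"
    have k: "real k \<le> (1 - \<eta>) * real d"
      using eta unfolding k_def by (simp add: of_nat_nat)
    \<comment> \<open>The depths are h + 1 and h + 2, so a link has (h + 1) + (h + 2) + 2 = 2 h + 5
      vertices. These are exactly the inner vertices of a subdivided edge; the odd number is why the
      depths differ by one.\<close>
    have card: "d + d * d + d * d * ((h + 1) + (h + 2) + 2) + (h + 1) + (h + 2) + 4 * 3 ^ q + 13 * m \<le> card {..<n}"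
    proof -
      define D where "D = real d * real d"
      have D: "real d \<le> D" "1 \<le> D" using d_sq d_pos unfolding D_def by linarith+
      have "real (d + d * d + d * d * ((h + 1) + (h + 2) + 2) + (h + 1) + (h + 2))
          = real d + D + D * (2 * real h + 5) + (2 * real h + 3)" by (simp add: D_def algebra_simps)
      also have "\<dots> \<le> D + D + D * (2 * real h + 5) + D * (2 * real h + 3)"
        using D(1) mult_right_mono[OF D(2), of "2 * real h + 3"] by (intro add_mono) simp_all
      also have "\<dots> = D * (4 * real h + 10)" by (simp add: algebra_simps)
      also have "\<dots> \<le> real n powr (1 - 2 * \<epsilon>) * (4 * ln (real n) + 20)"
        using dd D h(2) by (intro mult_mono) (auto simp: D_def)
      also have "\<dots> \<le> real n / 2" by (rule n2)
      finally have 1: "real (d + d * d + d * d * ((h + 1) + (h + 2) + 2) + (h + 1) + (h + 2)) \<le> real n / 2" .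
      have "real (4 * 3 ^ q + 13 * m) \<le> real (25 * m)" using q3 unfolding of_nat_le_iff by linarith
      also have "\<dots> \<le> real n / 2" using m(2) x n_pos unfolding of_nat_mult of_nat_numeral by linarith
      finally have "real (d + d * d + d * d * ((h + 1) + (h + 2) + 2) + (h + 1) + (h + 2) + (4 * 3 ^ q + 13 * m)) \<le> real n"
        using 1 unfolding of_nat_add by linarith
      then show ?thesis unfolding of_nat_le_iff card_lessThan by linarith
    qed
    have "q \<le> h + 2" using q(2) by simp
    from ex_linked_stars[OF k q(1,2) this card] obtain c Q where cQ: "inj_on c {..<k}" "c ` {..<k} \<subseteq> {..<n}"
      "\<forall>i j. i < j \<and> j < k \<longrightarrow> link (c i # Q i j @ [c j]) (c i) (c j) \<and>
         length (Q i j) = (h + 1) + (h + 2) + 2 \<and> set (Q i j) \<inter> c ` {..<k} = {}"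
      "\<forall>i j i' j'. i < j \<and> j < k \<and> i' < j' \<and> j' < k \<and> (i, j) \<noteq> (i', j') \<longrightarrow> set (Q i j) \<inter> set (Q i' j') = {}"
      by (elim exE conjE)
    define P where "P i j = c i # Q i j @ [c j]" for i j
    have int: "Defs.interior (P i j) = set (Q i j)" for i j by (simp add: Defs.interior_def P_def)
    have path: "is_path n E (P i j)" "hd (P i j) = c i" "last (P i j) = c j"
      if "i < j \<and> j < k" for i j
      using cQ(3)[rule_format, OF that] unfolding is_path_def link_def P_def[symmetric] N_def by auto
    have l: "nat (2 * \<lceil>ln (\<eta>\<^sup>2 * real n / 4096)\<rceil> + 5) = 2 * h + 5"
      using h(3) unfolding x_def by linarith
    have len: "length (P i j) = 2 * h + 5 + 2" if "i < j \<and> j < k" for i j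
      using cQ(3)[rule_format, OF that] by (simp add: P_def)
    show "has_Kk_l_subdivision n E (nat \<lfloor>(1 - \<eta>) * real d\<rfloor>) (nat (2 * \<lceil>ln (\<eta>\<^sup>2 * real n / 4096)\<rceil> + 5))"
      unfolding has_Kk_l_subdivision_def l k_def[symmetric]
    proof (intro exI[of _ c] exI[of _ P] conjI allI impI)
      fix i j assume ij: "i < j \<and> j < k"
      show "Defs.interior (P i j) \<inter> c ` {..<k} = {}" unfolding int using cQ(3)[rule_format, OF ij] by blast
    next
      fix i j i' j' assume "i < j \<and> j < k \<and> i' < j' \<and> j' < k \<and> (i, j) \<noteq> (i', j')"
      then show "Defs.interior (P i j) \<inter> Defs.interior (P i' j') = {}" unfolding int by (rule cQ(4)[rule_format])
    qed (use cQ(1,2) path len in auto)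
  qed
qed

end
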